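(* Let $X$ be a compact computable metric space with computable metric, $f:X\to X$ a computable map, and $\Phi\in C(X,\mathbb{R}^m)$. Suppose that $\mathrm{Rot}(\Phi)$ is computable with $\operatorname{int}\mathrm{Rot}(\Phi)\ne\emptyset$, and that there exists a Turing machine $\psi$ such that, for every $n\in\mathbb{N}$, $\psi(n)$ is a convex polytope (given as the convex hull of a finite list of points of $\mathbb{Q}^m$) whose Hausdorff distance to $\mathrm{Rot}(\Phi)$ is at most $2^{-n}$. Let $r:\operatorname{int}\mathrm{Rot}(\Phi)\to\mathbb{R}$ be the function such that $r(w)$ is the radius of the largest open ball centered at $w$ contained within $\operatorname{int}\mathrm{Rot}(\Phi)$. Then $r$ is computable.
   Context: $\mathrm{Rot}(\Phi)=\{\int\Phi\,d\mu:\mu \text{ an } f\text{-invariant Borel probability measure on }X\}\subset\mathbb{R}^m$ (integral componentwise); it is compact and convex. Computability. A computable metric space is a separable metric space $(X,d_X)$ with a fixed dense sequence $(s_1,s_2,\dots)$ (an injective function $\mathbb{N}\to X$ with dense image). An oracle for $\alpha\in X$ is a function $\phi:\mathbb{N}\to\mathbb{N}$ with $d_X(\alpha,s_{\phi(n)})<2^{-n}$; an oracle for $w\in\mathbb{R}^m$ is a function $\phi:\mathbb{N}\to\mathbb{Q}^m$ with $\|w-\phi(n)\|<2^{-n}$. A function $g:S\to Y$ between (a subset of) one such space and another with dense sequence $(t_i)$ is computable if there is an oracle Turing machine which, for every $\alpha\in S$, given any oracle for $\alpha$ and any $n\in\mathbb{N}$, outputs (the index of) a point of the dense sequence of $Y$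 at distance less than $2^{-n}$ from $g(\alpha)$. A compact $S\subset\mathbb{R}^m$ is computable if there is a Turing machine which on input $n$ outputs a finite list of pairs $(c_i,l_i)\in\mathbb{Q}^m\times\mathbb{Z}$ such that the Hausdorff distance between $\bigcup_i\overline{B}(c_i,2^{-l_i})$ and $S$ is less than $2^{-n}$. *)

theory Defs
  imports "HOL-Probability.Probability" "HOL-Library.Nat_Bijection"
begin

section \<open>Multitape (oracle) Turing machines\<close>

text \<open>A tape is two-way infinite and is stored relative to its head: the head scans cell 0, and a
  head movement shifts the contents. Symbol 0 is the blank. A number is written in unary, as a block
  of symbols 1 starting at the head.\<close>

type_synonym tape = "int \<Rightarrow> nat"

datatype move = Move_Left | Move_Right | Stay

fun move_head :: "move \<Rightarrow> tape \<Rightarrow> tape" where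
  "move_head Move_Left t = (\<lambda>i. t (i - 1))"
| "move_head Move_Right t = (\<lambda>i. t (i + 1))"
| "move_head Stay t = t"

definition write_num :: "nat \<Rightarrow> tape" where
  "write_num n = (\<lambda>i. if 0 \<le> i \<and> i < int n then 1 else 0)"

definition read_num :: "tape \<Rightarrow> nat" where
  "read_num t = (LEAST j. t (int j) \<noteq> 1)"

lemma read_num_write_num [simp]: "read_num (write_num n) = n"
  unfolding read_num_def write_num_def by (rule Least_equality) (auto split: if_splits intro: leI)

text \<open>The states of a machine are the positions in its finite list of instructions; execution starts
  in state 0, and every state beyond the end of the list is a halting state. \<open>Act \<delta>\<close> is an ordinary
  transition: \<open>\<delta>\<close> maps the list of scanned symbols to the next state and, for each tape, the symbol
  to write and the head movement. \<open>Query q\<close> replaces the number on the query tape (tape 1) by the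
  oracle's answer and continues in state \<open>q\<close>.\<close>

datatype instr = Act "nat list \<Rightarrow> nat \<times> (nat \<times> move) list" | Query nat

record machine =
  num_tapes :: nat
  num_symbols :: nat
  instrs :: "instr list"

text \<open>Transition functions are relevant only on the finitely many lists of length \<open>num_tapes M\<close> over
  the alphabet \<open>{..<num_symbols M}\<close>, so a well-formed machine is a finite object.\<close>

definition oracle_turing_machine :: "machine \<Rightarrow> bool" where
  "oracle_turing_machine M \<longleftrightarrow>
     2 \<le> num_tapes M \<and> 2 \<le> num_symbols M \<and>
     (\<forall>\<delta>. Act \<delta> \<in> set (instrs M) \<longrightarrow>
        (\<forall>as. length as = num_tapes M \<and> set as \<subseteq> {..<num_symbols M} \<longrightarrow>
           length (snd (\<delta> as)) = num_tapes M \<and> fst ` set (snd (\<delta> as)) \<subseteq> {..<num_symbols M}))"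

definition turing_machine :: "machine \<Rightarrow> bool" where
  "turing_machine M \<longleftrightarrow> oracle_turing_machine M \<and> (\<forall>q. Query q \<notin> set (instrs M))"

fun exec_instr :: "(nat \<Rightarrow> nat) \<Rightarrow> instr \<Rightarrow> tape list \<Rightarrow> nat \<times> tape list" where
  "exec_instr \<phi> (Act \<delta>) ts =
     (let (q, ws) = \<delta> (map (\<lambda>t. t 0) ts)
      in (q, map2 (\<lambda>t (a, d). move_head d (t(0 := a))) ts ws))"
| "exec_instr \<phi> (Query q) ts = (q, ts[1 := write_num (\<phi> (read_num (ts ! 1)))])"

definition halted :: "machine \<Rightarrow> nat \<times> tape list \<Rightarrow> bool" where
  "halted M c \<longleftrightarrow> length (instrs M) \<le> fst c"

definition step :: "machine \<Rightarrow> (nat \<Rightarrow> nat) \<Rightarrow> nat \<times> tape list \<Rightarrow> nat \<times> tape list" where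
  "step M \<phi> c = (if halted M c then c else exec_instr \<phi> (instrs M ! fst c) (snd c))"

definition start :: "machine \<Rightarrow> nat \<Rightarrow> nat \<times> tape list" where
  "start M n = (0, write_num n # replicate (num_tapes M - 1) (write_num 0))"

text \<open>Tape 0 is both the input and the output tape.\<close>

definition oracle_outputs :: "machine \<Rightarrow> (nat \<Rightarrow> nat) \<Rightarrow> nat \<Rightarrow> nat \<Rightarrow> bool" where
  "oracle_outputs M \<phi> n k \<longleftrightarrow>
     (\<exists>T. let c = (step M \<phi> ^^ T) (start M n) in halted M c \<and> read_num (snd c ! 0) = k)"

text \<open>For a machine without queries the oracle is irrelevant.\<close>

definition outputs :: "machine \<Rightarrow> nat \<Rightarrow> nat \<Rightarrow> bool" where
  "outputs M n k \<longleftrightarrow> oracle_outputs M (\<lambda>_. 0) n k"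


section \<open>Codes for rational data\<close>

definition rat_code :: "rat \<Rightarrow> nat" where
  "rat_code q = prod_encode (int_encode (fst (quotient_of q)), nat (snd (quotient_of q)))"

text \<open>\<open>from_nat_into UNIV\<close> enumerates the finite index type \<open>'m\<close> as \<open>0, \<dots>, CARD('m) - 1\<close>.\<close>

definition rat_vec_code :: "rat ^ 'm \<Rightarrow> nat" where
  "rat_vec_code v =
     list_encode (map (\<lambda>i. rat_code (v $ from_nat_into (UNIV :: 'm set) i)) [0..<CARD('m)])"

definition real_vec :: "rat ^ 'm \<Rightarrow> real ^ 'm" where
  "real_vec v = (\<chi> i. of_rat (v $ i))"

definition points_code :: "(rat ^ 'm) list \<Rightarrow> nat" where
  "points_code ps = list_encode (map rat_vec_code ps)"

definition balls_code :: "((rat ^ 'm) \<times> int) list \<Rightarrow> nat" where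
  "balls_code bs = list_encode (map (\<lambda>(c, l). prod_encode (rat_vec_code c, int_encode l)) bs)"

lemma inj_rat_code: "inj rat_code"
proof (rule injI)
  fix p q :: rat
  assume eq: "rat_code p = rat_code q"
  have "snd (quotient_of p) > 0" "snd (quotient_of q) > 0"
    by (rule quotient_of_denom_pos')+
  with eq have "quotient_of p = quotient_of q"
    by (auto simp: rat_code_def prod_eq_iff inj_eq[OF inj_int_encode] eq_nat_nat_iff)
  then show "p = q"
    by (rule quotient_of_inject)
qed

lemma inj_rat_vec_code: "inj (rat_vec_code :: rat ^ 'm \<Rightarrow> nat)"
proof (rule injI)
  fix u v :: "rat ^ 'm"
  let ?e = "from_nat_into (UNIV :: 'm set)"
  assume "rat_vec_code u = rat_vec_code v"
  then have *: "u $ ?e i = v $ ?e i" if "i < CARD('m)" for i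
    using that by (auto simp: rat_vec_code_def inj_eq[OF inj_list_encode] inj_eq[OF inj_rat_code])
  have "bij_betw ?e {..<CARD('m)} UNIV"
    by (rule bij_betw_from_nat_into_finite) simp
  then have "?e ` {..<CARD('m)} = UNIV"
    by (rule bij_betw_imp_surj_on)
  then have "u $ x = v $ x" for x
    using * by (metis UNIV_I imageE lessThan_iff)
  then show "u = v" by (simp add: vec_eq_iff)
qed


section \<open>Computable analysis\<close>

text \<open>A space with a distinguished dense sequence enters the notion of a computable function only
  through the relation ``\<open>k\<close> names a point of the dense sequence at distance less than \<open>2\<^sup>-\<^sup>n\<close>
  from \<open>x\<close>''. For \<open>\<real>\<close> and \<open>\<real>\<^sup>m\<close> the dense set consists of the rational points, named by their codes.\<close>

type_synonym 'a approximation = "'a \<Rightarrow> nat \<Rightarrow> nat \<Rightarrow> bool"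

definition approx_seq :: "(nat \<Rightarrow> 'a::metric_space) \<Rightarrow> 'a approximation" where
  "approx_seq s x n k \<longleftrightarrow> dist x (s k) < 1 / 2 ^ n"

definition approx_real :: "real approximation" where
  "approx_real x n k \<longleftrightarrow> (\<exists>q. k = rat_code q \<and> \<bar>x - of_rat q\<bar> < 1 / 2 ^ n)"

definition approx_vec :: "(real ^ 'm) approximation" where
  "approx_vec w n k \<longleftrightarrow> (\<exists>v. k = rat_vec_code v \<and> norm (w - real_vec v) < 1 / 2 ^ n)"

definition is_oracle :: "'a approximation \<Rightarrow> (nat \<Rightarrow> nat) \<Rightarrow> 'a \<Rightarrow> bool" where
  "is_oracle A \<phi> x \<longleftrightarrow> (\<forall>n. A x n (\<phi> n))"

definition computable_on :: "'a set \<Rightarrow> 'a approximation \<Rightarrow> 'b approximation \<Rightarrow> ('a \<Rightarrow> 'b) \<Rightarrow> bool" where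
  "computable_on S A B g \<longleftrightarrow>
     (\<exists>M. oracle_turing_machine M \<and>
        (\<forall>x\<in>S. \<forall>\<phi>. is_oracle A \<phi> x \<longrightarrow> (\<forall>n. \<exists>k. oracle_outputs M \<phi> n k \<and> B (g x) n k)))"

definition computable_metric_space :: "(nat \<Rightarrow> 'a::metric_space) \<Rightarrow> bool" where
  "computable_metric_space s \<longleftrightarrow> inj s \<and> closure (range s) = UNIV"

text \<open>The metric is computable as a function on the product space, whose dense sequence is obtained
  from \<open>s\<close> by the pairing function.\<close>

definition pair_seq :: "(nat \<Rightarrow> 'a) \<Rightarrow> nat \<Rightarrow> 'a \<times> 'a" where
  "pair_seq s k = map_prod s s (prod_decode k)"

definition computable_metric :: "(nat \<Rightarrow> 'a::metric_space) \<Rightarrow> bool" where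
  "computable_metric s \<longleftrightarrow>
     computable_on UNIV (approx_seq (pair_seq s)) approx_real (\<lambda>(x, y). dist x y)"

text \<open>With values in the extended nonnegative reals, the distance between the empty set and a
  nonempty set is \<open>\<infinity>\<close>.\<close>

definition hausdorff_dist :: "'a::metric_space set \<Rightarrow> 'a set \<Rightarrow> ennreal" where
  "hausdorff_dist A B =
     max (SUP a\<in>A. INF b\<in>B. ennreal (dist a b)) (SUP b\<in>B. INF a\<in>A. ennreal (dist a b))"

text \<open>Meant for compact sets.\<close>

definition computable_set :: "(real ^ 'm) set \<Rightarrow> bool" where
  "computable_set S \<longleftrightarrow>
     (\<exists>M. turing_machine M \<and>
        (\<forall>n. \<exists>bs. outputs M n (balls_code bs) \<and>
           hausdorff_dist (\<Union>(c, l)\<in>set bs. cball (real_vec c) (2 powi (- l))) S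
             < ennreal (1 / 2 ^ n)))"


section \<open>Rotation sets\<close>

definition invariant_prob :: "('a::topological_space \<Rightarrow> 'a) \<Rightarrow> 'a measure \<Rightarrow> bool" where
  "invariant_prob f \<mu> \<longleftrightarrow>
     sets \<mu> = sets borel \<and> prob_space \<mu> \<and> (\<forall>A\<in>sets borel. emeasure \<mu> (f -` A) = emeasure \<mu> A)"

definition Rot :: "('a::topological_space \<Rightarrow> 'a) \<Rightarrow> ('a \<Rightarrow> real ^ 'm) \<Rightarrow> (real ^ 'm) set" where
  "Rot f \<Phi> = {(\<chi> i. \<integral>x. \<Phi> x $ i \<partial>\<mu>) | \<mu>. invariant_prob f \<mu>}"

definition largest_radius :: "'a::metric_space set \<Rightarrow> 'a \<Rightarrow> real" where
  "largest_radius U w = (GREATEST \<rho>. 0 < \<rho> \<and> ball w \<rho> \<subseteq> U)"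

end

theory Submission
  imports Defs
begin

text \<open>For a convex body \<open>K\<close> and \<open>w \<in> int K\<close>, the radius \<open>r(w)\<close> is the minimum over unit vectors \<open>u\<close> of
  \<open>h\<^sub>K(u) - u \<bullet> w\<close>, where \<open>h\<^sub>K\<close> is the support function. Hence replacing \<open>K\<close> by a polytope at Hausdorff
  distance \<open>\<epsilon>\<close> and \<open>w\<close> by a point at distance \<open>\<epsilon>\<close> changes it by at most \<open>2 \<epsilon>\<close>. For a polytope
  with vertices \<open>p\<^sub>i\<close>, after scaling by \<open>D = 2\<^sup>n\<^sup>+\<^sup>c\<close> and rounding to integers, the minimum of
  \<open>max\<^sub>i u \<bullet> (p\<^sub>i - w)\<close> is found up to a bounded error by running through the directions \<open>u\<close> of an integer
  grid of mesh size proportional to \<open>1 / D\<close>, which is a primitive recursive computation on natural numbers.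

  One call of the given machine and one oracle query therefore suffice. The resulting oracle machine
  saves \<open>n\<close>, runs the given machine on its own fresh tapes, queries the oracle, and then executes a program
  for a counter machine, each of whose registers is kept in unary on a tape of its own.\<close>

section \<open>Counter programs\<close>

text \<open>Three obstacles shape the proof. The norm of a grid direction g is irrational in
  general, so g is never normalised: an integer t is compared in the form "t times the norm of g is
  at most g \<bullet> y", and after a sign check both sides are squared into naturals. Since no
  negative numbers are available, coordinates carry the offset Z, directions the offset N, and inner
  products are split into two sums of naturals. Finally, replacing N u by an integer vector makes an
  error that is multiplied by the size of y, which is of order D; hence N is a constant multiple of
  D, and that constant contains a bound of K, which is built into the machine.

  K is the rotation set. Its convexity, which the separation argument needs, comes from mixing
  invariant measures, its boundedness from one of the given polytopes. Closedness is never
  established: separation goes through the closure of K, and an infimum in the Hausdorff distance is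
  replaced by a point at the price of a factor 2.\<close>

datatype com = Inc nat | Dec nat | Ask | Seq com com | If_nonzero nat com com | While nat com

text \<open>A relation and not a function, because a \<open>While\<close> loop may diverge.
  \<open>Ask\<close> is tied to register 1 because \<open>Query\<close> acts on tape 1.\<close>

inductive exec :: "(nat \<Rightarrow> nat) \<Rightarrow> com \<Rightarrow> (nat \<Rightarrow> nat) \<Rightarrow> (nat \<Rightarrow> nat) \<Rightarrow> bool" for \<phi> where
  exec_Inc: "exec \<phi> (Inc i) \<sigma> (\<sigma>(i := Suc (\<sigma> i)))"
| exec_Dec: "exec \<phi> (Dec i) \<sigma> (\<sigma>(i := \<sigma> i - 1))"
| exec_Ask: "exec \<phi> Ask \<sigma> (\<sigma>(1 := \<phi> (\<sigma> 1)))"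
| exec_Seq: "exec \<phi> c \<sigma> \<sigma>' \<Longrightarrow> exec \<phi> d \<sigma>' \<sigma>'' \<Longrightarrow> exec \<phi> (Seq c d) \<sigma> \<sigma>''"
| exec_If_then: "\<sigma> i \<noteq> 0 \<Longrightarrow> exec \<phi> c \<sigma> \<sigma>' \<Longrightarrow> exec \<phi> (If_nonzero i c d) \<sigma> \<sigma>'"
| exec_If_else: "\<sigma> i = 0 \<Longrightarrow> exec \<phi> d \<sigma> \<sigma>' \<Longrightarrow> exec \<phi> (If_nonzero i c d) \<sigma> \<sigma>'"
| exec_While_zero: "\<sigma> i = 0 \<Longrightarrow> exec \<phi> (While i c) \<sigma> \<sigma>"
| exec_While_nonzero: "\<sigma> i \<noteq> 0 \<Longrightarrow> exec \<phi> c \<sigma> \<sigma>' \<Longrightarrow> exec \<phi> (While i c) \<sigma>' \<sigma>'' \<Longrightarrow>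
    exec \<phi> (While i c) \<sigma> \<sigma>''"

fun reg_bound :: "com \<Rightarrow> nat" where
  "reg_bound (Inc i) = Suc i"
| "reg_bound (Dec i) = Suc i"
| "reg_bound Ask = 2"
| "reg_bound (Seq c d) = max (reg_bound c) (reg_bound d)"
| "reg_bound (If_nonzero i c d) = max (Suc i) (max (reg_bound c) (reg_bound d))"
| "reg_bound (While i c) = max (Suc i) (reg_bound c)"

section \<open>Translation of counter programs into Turing machine instructions\<close>

definition stay :: "nat list \<Rightarrow> (nat \<times> move) list" where
  "stay as = map (\<lambda>a. (a, Stay)) as"

definition jump :: "nat \<Rightarrow> instr" where
  "jump q = Act (\<lambda>as. (q, stay as))"

text \<open>The test is against 1 and not against the blank because any symbol other than 1 ends a
  unary block; tapes left behind by the given machine may carry further symbols.\<close>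

definition branch :: "nat \<Rightarrow> nat \<Rightarrow> nat \<Rightarrow> instr" where
  "branch i p q = Act (\<lambda>as. (if as ! i = 1 then p else q, stay as))"

fun code_size :: "com \<Rightarrow> nat" where
  "code_size (Inc i) = 2"
| "code_size (Dec i) = 1"
| "code_size Ask = 1"
| "code_size (Seq c d) = code_size c + code_size d"
| "code_size (If_nonzero i c d) = code_size c + code_size d + 2"
| "code_size (While i c) = code_size c + 2"

text \<open>Register \<open>i\<close> is the block of ones at the head of tape \<open>i\<close>: incrementing it means writing
  a 1 to the left of the head, decrementing it means erasing the scanned 1 and moving right.\<close>

fun compile :: "nat \<Rightarrow> com \<Rightarrow> instr list" where
  "compile p (Inc i) =
     [Act (\<lambda>as. (Suc p, (stay as)[i := (as ! i, Move_Left)])),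
      Act (\<lambda>as. (p + 2, (stay as)[i := (1, Stay)]))]"
| "compile p (Dec i) =
     [Act (\<lambda>as. (Suc p, if as ! i = 1 then (stay as)[i := (0, Move_Right)] else stay as))]"
| "compile p Ask = [Query (Suc p)]"
| "compile p (Seq c d) = compile p c @ compile (p + code_size c) d"
| "compile p (If_nonzero i c d) =
     branch i (Suc p) (p + code_size c + 2) # compile (Suc p) c @
     jump (p + code_size c + code_size d + 2) # compile (p + code_size c + 2) d"
| "compile p (While i c) =
     branch i (Suc p) (p + code_size c + 2) # compile (Suc p) c @ [jump p]"

lemma length_compile [simp]: "length (compile p c) = code_size c"
  by (induction c arbitrary: p) auto

text \<open>Isolates the condition on a single instruction, so that code assembled from several
  sources can be checked piece by piece.\<close>

definition well_formed_instr :: "nat \<Rightarrow> nat \<Rightarrow> instr \<Rightarrow> bool" where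
  "well_formed_instr k s I \<longleftrightarrow>
     (\<forall>\<delta> as. I = Act \<delta> \<longrightarrow> length as = k \<longrightarrow> set as \<subseteq> {..<s} \<longrightarrow>
        length (snd (\<delta> as)) = k \<and> fst ` set (snd (\<delta> as)) \<subseteq> {..<s})"

lemma well_formed_Act:
  assumes "\<And>as. length as = k \<Longrightarrow> set as \<subseteq> {..<s} \<Longrightarrow>
    length (snd (\<delta> as)) = k \<and> fst ` set (snd (\<delta> as)) \<subseteq> {..<s}"
  shows "well_formed_instr k s (Act \<delta>)"
  using assms unfolding well_formed_instr_def by blast

lemma oracle_turing_machine_iff:
  "oracle_turing_machine M \<longleftrightarrow> 2 \<le> num_tapes M \<and> 2 \<le> num_symbols M \<and>
     (\<forall>I\<in>set (instrs M). well_formed_instr (num_tapes M) (num_symbols M) I)"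
  unfolding oracle_turing_machine_def well_formed_instr_def by blast

lemma length_stay [simp]: "length (stay as) = length as"
  by (simp add: stay_def)

lemma fst_stay [simp]: "fst ` set (stay as) = set as"
  by (auto simp: stay_def image_iff)

lemma well_formed_branch: "well_formed_instr k s (branch i p q)"
  and well_formed_jump: "well_formed_instr k s (jump q)"
  unfolding branch_def jump_def by (rule well_formed_Act; simp only: snd_conv length_stay fst_stay)+

lemma fst_stay_update:
  assumes "set as \<subseteq> S" "a \<in> S"
  shows "fst ` set ((stay as)[i := (a, d)]) \<subseteq> S"
proof -
  have "set ((stay as)[i := (a, d)]) \<subseteq> insert (a, d) (set (stay as))"
    by (rule set_update_subset_insert)
  then have "fst ` set ((stay as)[i := (a, d)]) \<subseteq> insert a (set as)"
    using fst_stay[of as] by (metis fst_conv image_insert image_mono)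
  then show ?thesis
    using assms by blast
qed

lemma well_formed_compile:
  assumes "2 \<le> s" "reg_bound c \<le> k" "I \<in> set (compile p c)"
  shows "well_formed_instr k s I"
  using assms(2,3)
proof (induction c arbitrary: p)
  case (Inc i)
  have "well_formed_instr k s (Act (\<lambda>as. (Suc p, (stay as)[i := (as ! i, Move_Left)])))"
  proof (rule well_formed_Act, intro conjI, goal_cases)
    case (2 as)
    then have "as ! i < s"
      using Inc.prems(1) by (metis Suc_le_eq lessThan_iff nth_mem reg_bound.simps(1) subsetD)
    then show ?case
      using fst_stay_update[OF 2(2)] unfolding snd_conv by blast
  qed simp
  moreover have "well_formed_instr k s (Act (\<lambda>as. (p + 2, (stay as)[i := (1, Stay)])))"
  proof (rule well_formed_Act, intro conjI, goal_cases)
    case (2 as)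
    then show ?case
      using assms(1) unfolding snd_conv by (intro fst_stay_update) simp_all
  qed simp
  ultimately show ?case
    using Inc.prems(2) by auto
next
  case (Dec i)
  have "well_formed_instr k s
      (Act (\<lambda>as. (Suc p, if as ! i = 1 then (stay as)[i := (0, Move_Right)] else stay as)))"
  proof (rule well_formed_Act, intro conjI, goal_cases)
    case (2 as)
    then have "fst ` set ((stay as)[i := (0, Move_Right)]) \<subseteq> {..<s}"
      using assms(1) by (intro fst_stay_update) simp_all
    then show ?case
      using 2 by (simp split: if_split)
  qed simp
  then show ?case
    using Dec.prems(2) by simp
next
  case Ask
  then show ?case by (auto simp: well_formed_instr_def)
next
  case (Seq c d)
  then show ?case by auto
next
  case (If_nonzero i c d)
  then show ?case by (auto simp: well_formed_branch well_formed_jump)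
next
  case (While i c)
  then show ?case by (auto simp: well_formed_branch well_formed_jump)
qed

section \<open>Simulation of counter programs by the compiled code\<close>

definition reaches :: "machine \<Rightarrow> (nat \<Rightarrow> nat) \<Rightarrow> nat \<times> tape list \<Rightarrow> nat \<times> tape list \<Rightarrow> bool" where
  "reaches M \<phi> c c' \<longleftrightarrow> (\<exists>T. (step M \<phi> ^^ T) c = c')"

lemma reaches_refl: "reaches M \<phi> c c"
  unfolding reaches_def by (rule exI[of _ 0]) simp

lemma reaches_step: "step M \<phi> c = c' \<Longrightarrow> reaches M \<phi> c c'"
  unfolding reaches_def by (rule exI[of _ 1]) simp

lemma reaches_trans [trans]:
  assumes "reaches M \<phi> c c'" "reaches M \<phi> c' c''"
  shows "reaches M \<phi> c c''"
proof -
  obtain T U where "(step M \<phi> ^^ T) c = c'" "(step M \<phi> ^^ U) c' = c''"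
    using assms by (auto simp: reaches_def)
  then have "(step M \<phi> ^^ (U + T)) c = c''"
    by (simp add: funpow_add)
  then show ?thesis
    unfolding reaches_def by blast
qed

definition code_at :: "machine \<Rightarrow> nat \<Rightarrow> instr list \<Rightarrow> bool" where
  "code_at M p is \<longleftrightarrow> (\<exists>xs ys. instrs M = xs @ is @ ys \<and> length xs = p)"

lemma code_at_append: "code_at M p (is @ js) \<Longrightarrow> code_at M p is \<and> code_at M (p + length is) js"
  unfolding code_at_def by (metis append.assoc length_append)

lemma code_at_Cons: "code_at M p (I # is) \<Longrightarrow> code_at M p [I] \<and> code_at M (Suc p) is"
  using code_at_append[of M p "[I]" "is"] by simp

lemma step_code_at:
  assumes "code_at M p [I]"
  shows "step M \<phi> (p, ts) = exec_instr \<phi> I ts"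
  using assms unfolding code_at_def step_def halted_def by (auto simp: nth_append)

text \<open>Junk beyond the block of ones is harmless for counter programs, but the tapes handed over to
  a given machine have to be exact.\<close>

definition tape_holds :: "bool \<Rightarrow> tape \<Rightarrow> nat \<Rightarrow> bool" where
  "tape_holds exact t n \<longleftrightarrow>
     (\<forall>j<n. t (int j) = 1) \<and> t (int n) \<noteq> 1 \<and> (exact \<longrightarrow> t = write_num n)"

definition tapes_hold :: "bool \<Rightarrow> tape list \<Rightarrow> (nat \<Rightarrow> nat) \<Rightarrow> bool" where
  "tapes_hold exact ts \<sigma> \<longleftrightarrow> (\<forall>i<length ts. tape_holds exact (ts ! i) (\<sigma> i))"

lemma tape_holds_write_num: "tape_holds exact (write_num n) n"
  by (auto simp: tape_holds_def write_num_def)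

lemma read_num_tape_holds: "tape_holds exact t n \<Longrightarrow> read_num t = n"
  unfolding read_num_def tape_holds_def by (rule Least_equality) (auto intro: leI)

lemma scan_tape_holds: "tape_holds exact t n \<Longrightarrow> t 0 = 1 \<longleftrightarrow> n \<noteq> 0"
  unfolding tape_holds_def by (cases n) force+

lemma tape_holds_inc:
  assumes "tape_holds exact t n"
  shows "tape_holds exact ((\<lambda>i. t (i - 1))(0 := 1)) (Suc n)"
proof -
  have "t (int j - 1) = 1" if "j < Suc n" "j \<noteq> 0" for j
    using assms that by (cases j) (auto simp: tape_holds_def)
  moreover have "t (int (Suc n) - 1) \<noteq> 1"
    using assms by (simp add: tape_holds_def)
  moreover have "(\<lambda>i. write_num n (i - 1))(0 := 1) = write_num (Suc n)"
    by (auto simp: write_num_def fun_eq_iff)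
  ultimately show ?thesis
    using assms unfolding tape_holds_def by auto
qed

lemma tape_holds_dec:
  assumes "tape_holds exact t (Suc n)"
  shows "tape_holds exact (\<lambda>i. (t(0 := 0)) (i + 1)) n"
proof -
  have "t (int (Suc j)) = 1" if "j < n" for j
    using assms that unfolding tape_holds_def by (metis Suc_mono)
  moreover have "(\<lambda>i. ((write_num (Suc n))(0 := 0)) (i + 1)) = write_num n"
    by (auto simp: write_num_def fun_eq_iff)
  ultimately show ?thesis
    using assms unfolding tape_holds_def by (auto simp: algebra_simps)
qed

lemma tapes_hold_update:
  "tapes_hold exact ts \<sigma> \<Longrightarrow> tape_holds exact t n \<Longrightarrow> tapes_hold exact (ts[i := t]) (\<sigma>(i := n))"
  by (auto simp: tapes_hold_def nth_list_update)

lemma act_stay: "map2 (\<lambda>t (a, d). move_head d (t(0 := a))) ts (stay (map (\<lambda>t. t 0) ts)) = ts"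
  by (rule nth_equalityI) (auto simp: stay_def)

lemma act_update:
  "map2 (\<lambda>t (a, d). move_head d (t(0 := a))) ts ((stay (map (\<lambda>t. t 0) ts))[i := (a, d)]) =
     ts[i := move_head d ((ts ! i)(0 := a))]"
proof (rule nth_equalityI, goal_cases)
  case (2 j)
  then show ?case
    by (cases "i = j") (auto simp: stay_def)
qed simp

lemma step_jump: "code_at M p [jump q] \<Longrightarrow> step M \<phi> (p, ts) = (q, ts)"
  by (simp add: step_code_at jump_def act_stay)

lemma step_branch:
  assumes "code_at M p [branch i q q']" "tapes_hold exact ts \<sigma>" "i < length ts"
  shows "step M \<phi> (p, ts) = (if \<sigma> i \<noteq> 0 then q else q', ts)"
  using assms scan_tape_holds[of exact "ts ! i" "\<sigma> i"]
  by (simp add: step_code_at branch_def act_stay tapes_hold_def)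

text \<open>The flag \<open>exact\<close> is the same before and after: every instruction preserves
  exact tapes and tolerates junk. So one statement serves both the code that prepares the input of
  the given machine and the code that runs on its leftovers.\<close>

lemma compile_correct:
  assumes "exec \<phi> c \<sigma> \<sigma>'" "code_at M p (compile p c)" "tapes_hold exact ts \<sigma>" "length ts = k"
    and "reg_bound c \<le> k"
  shows "\<exists>ts'. reaches M \<phi> (p, ts) (p + code_size c, ts') \<and> tapes_hold exact ts' \<sigma>' \<and> length ts' = k"
  using assms
proof (induction arbitrary: p ts rule: exec.induct)
  case (exec_Inc i \<sigma>)
  let ?t = "ts ! i" and ?I = "Act (\<lambda>as. (Suc p, (stay as)[i := (as ! i, Move_Left)]))"
    and ?J = "Act (\<lambda>as. (p + 2, (stay as)[i := (1, Stay)]))"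
  have i: "i < length ts" using exec_Inc.prems by simp
  have code: "code_at M p [?I]" "code_at M (Suc p) [?J]"
    using exec_Inc.prems(1) code_at_Cons[of M p ?I "[?J]"] by auto
  \<comment> \<open>The head writes before it moves, so the new 1 takes a second
    instruction.\<close>
  have "step M \<phi> (p, ts) = (Suc p, ts[i := (\<lambda>j. ?t (j - 1))])"
    using i by (simp add: step_code_at[OF code(1)] act_update)
  moreover have "step M \<phi> (Suc p, us) = (p + 2, us[i := (us ! i)(0 := 1)])" for us
    by (simp add: step_code_at[OF code(2)] act_update)
  ultimately have "reaches M \<phi> (p, ts) (p + 2, ts[i := (\<lambda>j. ?t (j - 1))(0 := 1)])"
    using i by (metis length_list_update list_update_overwrite nth_list_update_eq reaches_step reaches_trans)
  moreover have "tape_holds exact ((\<lambda>j. ?t (j - 1))(0 := 1)) (Suc (\<sigma> i))"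
    using exec_Inc.prems i by (intro tape_holds_inc) (auto simp: tapes_hold_def)
  ultimately show ?case
    using exec_Inc.prems tapes_hold_update by (metis code_size.simps(1) length_list_update)
next
  case (exec_Dec i \<sigma>)
  let ?t = "ts ! i"
  have i: "i < length ts" using exec_Dec.prems by simp
  have holds: "tape_holds exact ?t (\<sigma> i)"
    using exec_Dec.prems i by (simp add: tapes_hold_def)
  show ?case
  proof (cases "\<sigma> i")
    case 0
    then have "step M \<phi> (p, ts) = (Suc p, ts)"
      using exec_Dec.prems i scan_tape_holds[OF holds] by (simp add: step_code_at act_stay)
    then show ?thesis
      using 0 exec_Dec.prems by (auto intro!: exI[of _ ts] reaches_step simp: fun_upd_idem)
  next
    case (Suc n)
    then have "step M \<phi> (p, ts) = (Suc p, ts[i := (\<lambda>j. (?t(0 := 0)) (j + 1))])"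
      using exec_Dec.prems i scan_tape_holds[OF holds] by (simp add: step_code_at act_update)
    then have "reaches M \<phi> (p, ts) (p + code_size (Dec i), ts[i := (\<lambda>j. (?t(0 := 0)) (j + 1))])"
      by (simp add: reaches_step)
    moreover have "tapes_hold exact (ts[i := (\<lambda>j. (?t(0 := 0)) (j + 1))]) (\<sigma>(i := \<sigma> i - 1))"
      using exec_Dec.prems holds Suc by (intro tapes_hold_update tape_holds_dec) auto
    ultimately show ?thesis
      using exec_Dec.prems(3) by (metis length_list_update)
  qed
next
  case (exec_Ask \<sigma>)
  have "read_num (ts ! 1) = \<sigma> 1"
    using exec_Ask.prems by (intro read_num_tape_holds[of exact]) (auto simp: tapes_hold_def)
  then have "step M \<phi> (p, ts) = (Suc p, ts[1 := write_num (\<phi> (\<sigma> 1))])"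
    using exec_Ask.prems by (simp add: step_code_at)
  then show ?case
    using exec_Ask.prems
    by (intro exI[of _ "ts[1 := write_num (\<phi> (\<sigma> 1))]"] conjI tapes_hold_update tape_holds_write_num)
      (simp_all add: reaches_step)
next
  case (exec_Seq c \<sigma> \<sigma>' d \<sigma>'')
  have code: "code_at M p (compile p c)" "code_at M (p + code_size c) (compile (p + code_size c) d)"
    using exec_Seq.prems(1) code_at_append by fastforce+
  obtain us where us: "reaches M \<phi> (p, ts) (p + code_size c, us)" "tapes_hold exact us \<sigma>'" "length us = k"
    using exec_Seq.IH(1)[OF code(1)] exec_Seq.prems by auto
  obtain vs where "reaches M \<phi> (p + code_size c, us) (p + code_size c + code_size d, vs)"
    "tapes_hold exact vs \<sigma>''" "length vs = k"
    using exec_Seq.IH(2)[OF code(2) us(2,3)] exec_Seq.prems by auto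
  then show ?case
    using us(1) reaches_trans by (metis add.assoc code_size.simps(4))
next
  case (exec_If_then \<sigma> i c \<sigma>' d)
  let ?b = "branch i (Suc p) (p + code_size c + 2)" and ?j = "jump (p + code_size c + code_size d + 2)"
  have code: "code_at M p [?b]" "code_at M (Suc p) (compile (Suc p) c)" "code_at M (Suc p + code_size c) [?j]"
    using exec_If_then.prems(1) code_at_Cons[of M p ?b]
      code_at_append[of M "Suc p" "compile (Suc p) c"] code_at_Cons[of M "Suc p + code_size c" ?j] by auto
  have "reaches M \<phi> (p, ts) (Suc p, ts)"
    using step_branch[OF code(1) exec_If_then.prems(2)] exec_If_then.hyps exec_If_then.prems
    by (auto intro!: reaches_step)
  moreover obtain us where us: "reaches M \<phi> (Suc p, ts) (Suc p + code_size c, us)"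
    "tapes_hold exact us \<sigma>'" "length us = k"
    using exec_If_then.IH[OF code(2)] exec_If_then.prems by auto
  moreover have "reaches M \<phi> (Suc p + code_size c, us) (p + code_size c + code_size d + 2, us)"
    using step_jump[OF code(3)] by (rule reaches_step)
  ultimately have "reaches M \<phi> (p, ts) (p + code_size c + code_size d + 2, us)"
    by (meson reaches_trans)
  then show ?case
    using us by (intro exI[of _ us]) (simp add: add.assoc)
next
  case (exec_If_else \<sigma> i d \<sigma>' c)
  let ?b = "branch i (Suc p) (p + code_size c + 2)" and ?j = "jump (p + code_size c + code_size d + 2)"
  have code: "code_at M p [?b]" "code_at M (p + code_size c + 2) (compile (p + code_size c + 2) d)"
    using exec_If_else.prems(1) code_at_Cons[of M p ?b]
      code_at_append[of M "Suc p" "compile (Suc p) c"] code_at_Cons[of M "Suc p + code_size c" ?j] by auto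
  have "reaches M \<phi> (p, ts) (p + code_size c + 2, ts)"
    using step_branch[OF code(1) exec_If_else.prems(2)] exec_If_else.hyps exec_If_else.prems
    by (auto intro!: reaches_step)
  moreover obtain us where us: "reaches M \<phi> (p + code_size c + 2, ts) (p + code_size c + 2 + code_size d, us)"
    "tapes_hold exact us \<sigma>'" "length us = k"
    using exec_If_else.IH[OF code(2)] exec_If_else.prems by auto
  ultimately have "reaches M \<phi> (p, ts) (p + code_size c + 2 + code_size d, us)"
    by (meson reaches_trans)
  then show ?case
    using us by (intro exI[of _ us]) (simp add: ac_simps)
next
  case (exec_While_zero \<sigma> i c)
  let ?b = "branch i (Suc p) (p + code_size c + 2)"
  have code: "code_at M p [?b]"
    using exec_While_zero.prems(1) code_at_Cons[of M p ?b] by auto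
  have "reaches M \<phi> (p, ts) (p + code_size c + 2, ts)"
    using step_branch[OF code exec_While_zero.prems(2)] exec_While_zero.hyps exec_While_zero.prems
    by (auto intro!: reaches_step)
  then show ?case
    using exec_While_zero.prems by (intro exI[of _ ts]) (simp add: add.assoc)
next
  case (exec_While_nonzero \<sigma> i c \<sigma>' \<sigma>'')
  let ?b = "branch i (Suc p) (p + code_size c + 2)"
  have code: "code_at M p [?b]" "code_at M (Suc p) (compile (Suc p) c)" "code_at M (Suc p + code_size c) [jump p]"
    using exec_While_nonzero.prems(1) code_at_Cons[of M p ?b]
      code_at_append[of M "Suc p" "compile (Suc p) c"] by auto
  have "reaches M \<phi> (p, ts) (Suc p, ts)"
    using step_branch[OF code(1) exec_While_nonzero.prems(2)] exec_While_nonzero.hyps exec_While_nonzero.prems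
    by (auto intro!: reaches_step)
  moreover obtain us where us: "reaches M \<phi> (Suc p, ts) (Suc p + code_size c, us)"
    "tapes_hold exact us \<sigma>'" "length us = k"
    using exec_While_nonzero.IH(1)[OF code(2)] exec_While_nonzero.prems by auto
  moreover have "reaches M \<phi> (Suc p + code_size c, us) (p, us)"
    using step_jump[OF code(3)] by (rule reaches_step)
  moreover obtain vs where vs: "reaches M \<phi> (p, us) (p + code_size (While i c), vs)"
    "tapes_hold exact vs \<sigma>''" "length vs = k"
    using exec_While_nonzero.IH(2)[OF exec_While_nonzero.prems(1) us(2,3)] exec_While_nonzero.prems by auto
  ultimately show ?case
    using vs by (meson reaches_trans)
qed

section \<open>Register programs for copying, addition and Cantor pairing\<close>

lemma exec_eq: "exec \<phi> c \<sigma> \<tau>' \<Longrightarrow> \<tau>' = \<tau> \<Longrightarrow> exec \<phi> c \<sigma> \<tau>"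
  by simp

text \<open>\<open>S k\<close> is the state with k iterations to go. A loop is thus verified by
  giving its intermediate states in closed form.\<close>

lemma exec_While_count:
  assumes "\<And>k. k < n \<Longrightarrow> exec \<phi> c (S (Suc k)) (S k)"
    and "\<And>k. k \<le> n \<Longrightarrow> S k i = 0 \<longleftrightarrow> k = 0"
  shows "exec \<phi> (While i c) (S n) (S 0)"
  using assms
proof (induction n)
  case 0
  then show ?case by (simp add: exec_While_zero)
next
  case (Suc n)
  have "exec \<phi> (While i c) (S n) (S 0)"
    using Suc.prems by (intro Suc.IH) auto
  moreover have "exec \<phi> c (S (Suc n)) (S n)" "S (Suc n) i \<noteq> 0"
    using Suc.prems by auto
  ultimately show ?case
    by (blast intro: exec_While_nonzero)
qed

definition Clear :: "nat \<Rightarrow> com" where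
  "Clear i = While i (Dec i)"

lemma exec_Clear: "exec \<phi> (Clear i) \<sigma> (\<sigma>(i := 0))"
proof -
  have "exec \<phi> (Clear i) (\<sigma>(i := \<sigma> i)) (\<sigma>(i := 0))"
    unfolding Clear_def
  proof (rule exec_While_count[where S = "\<lambda>k. \<sigma>(i := k)"])
    show "exec \<phi> (Dec i) (\<sigma>(i := Suc k)) (\<sigma>(i := k))" for k
      by (rule exec_eq[OF exec_Dec]) simp
  qed simp
  then show ?thesis by simp
qed

definition Move :: "nat \<Rightarrow> nat \<Rightarrow> com" where
  "Move i j = While i (Seq (Dec i) (Inc j))"

lemma exec_Move:
  assumes "i \<noteq> j"
  shows "exec \<phi> (Move i j) \<sigma> (\<sigma>(i := 0, j := \<sigma> j + \<sigma> i))"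
proof -
  define S where "S k = \<sigma>(i := k, j := \<sigma> j + (\<sigma> i - k))" for k
  have "exec \<phi> (Move i j) (S (\<sigma> i)) (S 0)"
    unfolding Move_def
  proof (rule exec_While_count[where S = S])
    show "exec \<phi> (Seq (Dec i) (Inc j)) (S (Suc k)) (S k)" if "k < \<sigma> i" for k
      by (rule exec_eq[OF exec_Seq[OF exec_Dec exec_Inc]])
        (use that assms in \<open>auto simp: S_def fun_eq_iff\<close>)
  qed (use assms in \<open>simp add: S_def\<close>)
  then show ?thesis
    using assms by (simp add: S_def fun_upd_idem)
qed

text \<open>Reading a register empties it; the scratch register \<open>s\<close> holds the second
  copy from which \<open>i\<close> is restored.\<close>

definition Copy :: "nat \<Rightarrow> nat \<Rightarrow> nat \<Rightarrow> com" where
  "Copy i j s = Seq (While i (Seq (Dec i) (Seq (Inc j) (Inc s)))) (Move s i)"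

lemma exec_Copy:
  assumes "i \<noteq> j" "i \<noteq> s" "j \<noteq> s" "\<sigma> s = 0"
  shows "exec \<phi> (Copy i j s) \<sigma> (\<sigma>(j := \<sigma> j + \<sigma> i))"
proof -
  define S where "S k = \<sigma>(i := k, j := \<sigma> j + (\<sigma> i - k), s := \<sigma> i - k)" for k
  have "exec \<phi> (While i (Seq (Dec i) (Seq (Inc j) (Inc s)))) (S (\<sigma> i)) (S 0)"
  proof (rule exec_While_count[where S = S])
    show "exec \<phi> (Seq (Dec i) (Seq (Inc j) (Inc s))) (S (Suc k)) (S k)" if "k < \<sigma> i" for k
      by (rule exec_eq[OF exec_Seq[OF exec_Dec exec_Seq[OF exec_Inc exec_Inc]]])
        (use that assms in \<open>auto simp: S_def fun_eq_iff\<close>)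
  qed (use assms in \<open>simp add: S_def\<close>)
  moreover have "S (\<sigma> i) = \<sigma>"
    using assms by (auto simp: S_def fun_eq_iff)
  ultimately have 1: "exec \<phi> (While i (Seq (Dec i) (Seq (Inc j) (Inc s)))) \<sigma> (S 0)"
    by (simp only:)
  show ?thesis
    unfolding Copy_def
    by (rule exec_eq[OF exec_Seq[OF 1 exec_Move]]) (use assms in \<open>auto simp: S_def fun_eq_iff\<close>)
qed

text \<open>There is no skip command, so adding 0 is an increment undone by a decrement.\<close>

primrec Add_const :: "nat \<Rightarrow> nat \<Rightarrow> com" where
  "Add_const i 0 = Seq (Inc i) (Dec i)"
| "Add_const i (Suc c) = Seq (Inc i) (Add_const i c)"

lemma exec_Add_const: "exec \<phi> (Add_const i c) \<sigma> (\<sigma>(i := \<sigma> i + c))"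
proof (induction c arbitrary: \<sigma>)
  case 0
  then show ?case
    by (auto intro!: exec_eq[OF exec_Seq[OF exec_Inc exec_Dec]])
next
  case (Suc c)
  then show ?case
    by (auto intro!: exec_eq[OF exec_Seq[OF exec_Inc Suc]])
qed

lemma triangle_mono: "m \<le> n \<Longrightarrow> triangle m \<le> triangle n"
  unfolding triangle_def by (intro div_le_mono mult_le_mono) auto

text \<open>The code of (a, b) is \<open>triangle (a + b) + a\<close>. The first loop leaves a + b
  in register \<open>i + 1\<close> and a in \<open>i + 2\<close>; the second adds a + b, a + b - 1,
  ..., 1 to the latter, using the emptied register \<open>i\<close> as scratch.\<close>

definition Pair_regs :: "nat \<Rightarrow> com" where
  "Pair_regs i =
     Seq (While i (Seq (Dec i) (Seq (Inc (i + 1)) (Inc (i + 2)))))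
       (Seq (While (i + 1) (Seq (Copy (i + 1) (i + 2) i) (Dec (i + 1)))) (Move (i + 2) i))"

lemma exec_Pair_regs:
  assumes "\<sigma> (i + 2) = 0"
  shows "exec \<phi> (Pair_regs i) \<sigma> (\<sigma>(i := prod_encode (\<sigma> i, \<sigma> (i + 1)), i + 1 := 0))"
proof -
  define n where "n = \<sigma> i + \<sigma> (i + 1)"
  define S where "S k = \<sigma>(i := k, i + 1 := n - k, i + 2 := \<sigma> i - k)" for k
  define R where "R k = \<sigma>(i := 0, i + 1 := k, i + 2 := \<sigma> i + (triangle n - triangle k))" for k
  have "exec \<phi> (While i (Seq (Dec i) (Seq (Inc (i + 1)) (Inc (i + 2))))) (S (\<sigma> i)) (S 0)"
  proof (rule exec_While_count[where S = S])
    show "exec \<phi> (Seq (Dec i) (Seq (Inc (i + 1)) (Inc (i + 2)))) (S (Suc k)) (S k)" if "k < \<sigma> i" for k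
      by (rule exec_eq[OF exec_Seq[OF exec_Dec exec_Seq[OF exec_Inc exec_Inc]]])
        (use that in \<open>auto simp: S_def fun_eq_iff n_def\<close>)
  qed (simp add: S_def)
  moreover have "S (\<sigma> i) = \<sigma>"
    using assms by (auto simp: S_def fun_eq_iff n_def)
  moreover have "S 0 = R n"
    by (auto simp: S_def R_def fun_eq_iff)
  ultimately have 1: "exec \<phi> (While i (Seq (Dec i) (Seq (Inc (i + 1)) (Inc (i + 2))))) \<sigma> (R n)"
    by (simp only:)
  have 2: "exec \<phi> (While (i + 1) (Seq (Copy (i + 1) (i + 2) i) (Dec (i + 1)))) (R n) (R 0)"
  proof (rule exec_While_count[where S = R])
    show "exec \<phi> (Seq (Copy (i + 1) (i + 2) i) (Dec (i + 1))) (R (Suc k)) (R k)" if "k < n" for k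
    proof -
      have "triangle (Suc k) \<le> triangle n"
        using that by (intro triangle_mono) simp
      then show ?thesis
        by (intro exec_eq[OF exec_Seq[OF exec_Copy exec_Dec]]) (auto simp: R_def fun_eq_iff)
    qed
  qed (simp add: R_def)
  have 3: "exec \<phi> (Move (i + 2) i) (R 0) (\<sigma>(i := prod_encode (\<sigma> i, \<sigma> (i + 1)), i + 1 := 0))"
    by (rule exec_eq[OF exec_Move])
      (use assms in \<open>auto simp: R_def fun_eq_iff prod_encode_def n_def\<close>)
  show ?thesis
    unfolding Pair_regs_def by (rule exec_Seq[OF 1 exec_Seq[OF 2 3]])
qed

lemma prod_decode_Suc:
  "prod_decode (Suc z) = (case prod_decode z of (a, b) \<Rightarrow> if b = 0 then (0, Suc a) else (Suc a, b - 1))"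
proof -
  obtain a b where ab: "prod_decode z = (a, b)" by fastforce
  then have "z = prod_encode (a, b)"
    by (metis prod_decode_inverse)
  then have "Suc z = prod_encode (if b = 0 then (0, Suc a) else (Suc a, b - 1))"
    by (cases b) (auto simp: prod_encode_def)
  then show ?thesis
    by (simp add: ab)
qed

text \<open>Instead of inverting the triangular formula, the program walks along the Cantor
  enumeration: starting at (0, 0), the pair in registers \<open>i + 1\<close> and
  \<open>i + 2\<close> is advanced as often as the code says, by the rule of
  \<open>prod_decode_Suc\<close>.\<close>

definition Unpair_regs :: "nat \<Rightarrow> com" where
  "Unpair_regs i =
     Seq (While i (Seq (Dec i)
         (If_nonzero (i + 2) (Seq (Dec (i + 2)) (Inc (i + 1))) (Seq (Move (i + 1) (i + 2)) (Inc (i + 2))))))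
       (Seq (Move (i + 1) i) (Move (i + 2) (i + 1)))"

definition pfst :: "nat \<Rightarrow> nat" where "pfst z = fst (prod_decode z)"
definition psnd :: "nat \<Rightarrow> nat" where "psnd z = snd (prod_decode z)"

lemma pfst_prod_encode [simp]: "pfst (prod_encode (a, b)) = a"
  and psnd_prod_encode [simp]: "psnd (prod_encode (a, b)) = b"
  by (simp_all add: pfst_def psnd_def)

lemma exec_Unpair_regs:
  assumes "\<sigma> (i + 1) = 0" "\<sigma> (i + 2) = 0"
  shows "exec \<phi> (Unpair_regs i) \<sigma> (\<sigma>(i := pfst (\<sigma> i), i + 1 := psnd (\<sigma> i)))"
proof -
  define S where "S k = \<sigma>(i := k, i + 1 := pfst (\<sigma> i - k), i + 2 := psnd (\<sigma> i - k))" for k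
  let ?next = "If_nonzero (i + 2) (Seq (Dec (i + 2)) (Inc (i + 1))) (Seq (Move (i + 1) (i + 2)) (Inc (i + 2)))"
  have step: "exec \<phi> (Seq (Dec i) ?next) (S (Suc k)) (S k)" if "k < \<sigma> i" for k
  proof -
    let ?z = "\<sigma> i - Suc k"
    let ?\<tau> = "(S (Suc k))(i := k)"
    have k: "\<sigma> i - k = Suc ?z" using that by simp
    have "exec \<phi> ?next ?\<tau> (S k)"
    proof (cases "psnd ?z = 0")
      case True
      then have "exec \<phi> (Seq (Move (i + 1) (i + 2)) (Inc (i + 2))) ?\<tau> (S k)"
        by (intro exec_eq[OF exec_Seq[OF exec_Move exec_Inc]])
          (auto simp: S_def k fun_eq_iff pfst_def psnd_def prod_decode_Suc split: prod.splits)
      then show ?thesis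
        using True by (intro exec_If_else) (auto simp: S_def)
    next
      case False
      then have "exec \<phi> (Seq (Dec (i + 2)) (Inc (i + 1))) ?\<tau> (S k)"
        by (intro exec_eq[OF exec_Seq[OF exec_Dec exec_Inc]])
          (auto simp: S_def k fun_eq_iff pfst_def psnd_def prod_decode_Suc split: prod.splits)
      then show ?thesis
        using False by (intro exec_If_then) (auto simp: S_def)
    qed
    moreover have "exec \<phi> (Dec i) (S (Suc k)) ?\<tau>"
      by (rule exec_eq[OF exec_Dec]) (simp add: S_def)
    ultimately show ?thesis
      by (blast intro: exec_Seq)
  qed
  have "prod_decode 0 = (0, 0)"
    using prod_encode_inverse[of "(0, 0)"] unfolding prod_encode_def by simp
  then have S: "S (\<sigma> i) = \<sigma>"
    using assms by (auto simp: S_def fun_eq_iff pfst_def psnd_def)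
  have 1: "exec \<phi> (While i (Seq (Dec i) ?next)) (S (\<sigma> i)) (S 0)"
    by (rule exec_While_count[where S = S, OF step]) (simp_all add: S_def)
  have 2: "exec \<phi> (Seq (Move (i + 1) i) (Move (i + 2) (i + 1))) (S 0)
      (\<sigma>(i := pfst (\<sigma> i), i + 1 := psnd (\<sigma> i)))"
    by (intro exec_eq[OF exec_Seq[OF exec_Move exec_Move]])
      (use assms in \<open>auto simp: S_def fun_eq_iff\<close>)
  show ?thesis
    unfolding Unpair_regs_def using exec_Seq[OF 1 2] unfolding S .
qed

section \<open>Primitive recursive functions\<close>

text \<open>A unary version of primitive recursion: tuples are coded by pairing, so each function
  works on a single register, and iteration replaces the recursion scheme.\<close>

inductive prec :: "(nat \<Rightarrow> nat) \<Rightarrow> bool" where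
  prec_zero: "prec (\<lambda>_. 0)"
| prec_Suc: "prec Suc"
| prec_pred: "prec (\<lambda>x. x - 1)"
| prec_pfst: "prec pfst"
| prec_psnd: "prec psnd"
| prec_comp: "prec f \<Longrightarrow> prec g \<Longrightarrow> prec (\<lambda>x. f (g x))"
| prec_pair: "prec f \<Longrightarrow> prec g \<Longrightarrow> prec (\<lambda>x. prod_encode (f x, g x))"
| prec_funpow: "prec f \<Longrightarrow> prec (\<lambda>x. (f ^^ pfst x) (psnd x))"

text \<open>The registers form a stack: a program working on register \<open>b\<close> finds the registers above
  \<open>b\<close> empty and leaves them empty.\<close>

lemma prec_program:
  assumes "prec f"
  shows "\<exists>c. \<forall>\<phi> \<sigma>. (\<forall>i>b. \<sigma> i = 0) \<longrightarrow> exec \<phi> c \<sigma> (\<sigma>(b := f (\<sigma> b)))"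
  using assms
proof (induction arbitrary: b rule: prec.induct)
  case prec_zero
  then show ?case using exec_Clear by blast
next
  case prec_Suc
  then show ?case using exec_Inc by blast
next
  case prec_pred
  then show ?case using exec_Dec by blast
next
  case prec_pfst
  have "exec \<phi> (Seq (Unpair_regs b) (Clear (b + 1))) \<sigma> (\<sigma>(b := pfst (\<sigma> b)))"
    if "\<forall>i>b. \<sigma> i = 0" for \<phi> \<sigma>
    by (rule exec_eq[OF exec_Seq[OF exec_Unpair_regs exec_Clear]])
      (use that in \<open>auto simp: fun_eq_iff\<close>)
  then show ?case by blast
next
  case prec_psnd
  have "exec \<phi> (Seq (Unpair_regs b) (Seq (Clear b) (Move (b + 1) b))) \<sigma> (\<sigma>(b := psnd (\<sigma> b)))"
    if "\<forall>i>b. \<sigma> i = 0" for \<phi> \<sigma>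
    by (rule exec_eq[OF exec_Seq[OF exec_Unpair_regs exec_Seq[OF exec_Clear exec_Move]]])
      (use that in \<open>auto simp: fun_eq_iff\<close>)
  then show ?case by blast
next
  case (prec_comp f g)
  obtain c d where
    c: "\<And>\<phi> \<sigma>. \<forall>i>b. \<sigma> i = 0 \<Longrightarrow> exec \<phi> c \<sigma> (\<sigma>(b := f (\<sigma> b)))" and
    d: "\<And>\<phi> \<sigma>. \<forall>i>b. \<sigma> i = 0 \<Longrightarrow> exec \<phi> d \<sigma> (\<sigma>(b := g (\<sigma> b)))"
    using prec_comp.IH by metis
  have "exec \<phi> (Seq d c) \<sigma> (\<sigma>(b := f (g (\<sigma> b))))" if "\<forall>i>b. \<sigma> i = 0" for \<phi> \<sigma>
    by (rule exec_eq[OF exec_Seq[OF d c]]) (use that in auto)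
  then show ?case by blast
next
  case (prec_pair f g)
  obtain c d where
    c: "\<And>\<phi> \<sigma>. \<forall>i>b + 1. \<sigma> i = 0 \<Longrightarrow> exec \<phi> c \<sigma> (\<sigma>(b + 1 := f (\<sigma> (b + 1))))" and
    d: "\<And>\<phi> \<sigma>. \<forall>i>b + 2. \<sigma> i = 0 \<Longrightarrow> exec \<phi> d \<sigma> (\<sigma>(b + 2 := g (\<sigma> (b + 2))))"
    using prec_pair.IH by metis
  \<comment> \<open>\<open>d\<close> runs one register above the value computed by \<open>c\<close>,
    and the argument stays in \<open>b\<close> until it has been copied for both.\<close>
  let ?p = "Seq (Copy b (b + 1) (b + 2)) (Seq c (Seq (Copy b (b + 2) (b + 3)) (Seq d
    (Seq (Clear b) (Seq (Pair_regs (b + 1)) (Move (b + 1) b))))))"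
  have "exec \<phi> ?p \<sigma> (\<sigma>(b := prod_encode (f (\<sigma> b), g (\<sigma> b))))"
    if *: "\<forall>i>b. \<sigma> i = 0" for \<phi> \<sigma>
  proof -
    let ?x = "\<sigma> b" and ?z = "prod_encode (f (\<sigma> b), g (\<sigma> b))"
    have "exec \<phi> (Copy b (b + 1) (b + 2)) \<sigma> (\<sigma>(b + 1 := ?x))"
      by (rule exec_eq[OF exec_Copy]) (use * in auto)
    moreover have "exec \<phi> c (\<sigma>(b + 1 := ?x)) (\<sigma>(b + 1 := f ?x))"
      by (rule exec_eq[OF c]) (use * in auto)
    moreover have "exec \<phi> (Copy b (b + 2) (b + 3)) (\<sigma>(b + 1 := f ?x)) (\<sigma>(b + 1 := f ?x, b + 2 := ?x))"
      by (rule exec_eq[OF exec_Copy]) (use * in auto)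
    moreover have "exec \<phi> d (\<sigma>(b + 1 := f ?x, b + 2 := ?x)) (\<sigma>(b + 1 := f ?x, b + 2 := g ?x))"
      by (rule exec_eq[OF d]) (use * in auto)
    moreover have "exec \<phi> (Clear b) (\<sigma>(b + 1 := f ?x, b + 2 := g ?x)) (\<sigma>(b := 0, b + 1 := f ?x, b + 2 := g ?x))"
      by (rule exec_eq[OF exec_Clear]) (auto simp: fun_eq_iff)
    moreover have "exec \<phi> (Pair_regs (b + 1)) (\<sigma>(b := 0, b + 1 := f ?x, b + 2 := g ?x)) (\<sigma>(b := 0, b + 1 := ?z))"
      by (rule exec_eq[OF exec_Pair_regs]) (use * in \<open>auto simp: fun_eq_iff\<close>)
    moreover have "exec \<phi> (Move (b + 1) b) (\<sigma>(b := 0, b + 1 := ?z)) (\<sigma>(b := ?z))"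
      by (rule exec_eq[OF exec_Move]) (use * in \<open>auto simp: fun_eq_iff\<close>)
    ultimately show ?thesis
      by (blast intro: exec_Seq)
  qed
  then show ?case by blast
next
  case (prec_funpow f)
  obtain c where
    c: "\<And>\<phi> \<sigma>. \<forall>i>b + 1. \<sigma> i = 0 \<Longrightarrow> exec \<phi> c \<sigma> (\<sigma>(b + 1 := f (\<sigma> (b + 1))))"
    using prec_funpow.IH by metis
  let ?p = "Seq (Unpair_regs b) (Seq (While b (Seq (Dec b) c)) (Move (b + 1) b))"
  have "exec \<phi> ?p \<sigma> (\<sigma>(b := (f ^^ pfst (\<sigma> b)) (psnd (\<sigma> b))))"
    if *: "\<forall>i>b. \<sigma> i = 0" for \<phi> \<sigma>
  proof -
    let ?n = "pfst (\<sigma> b)" and ?y = "psnd (\<sigma> b)"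
    define S where "S k = \<sigma>(b := k, b + 1 := (f ^^ (?n - k)) ?y)" for k
    have "exec \<phi> (Unpair_regs b) \<sigma> (S ?n)"
      by (rule exec_eq[OF exec_Unpair_regs]) (use * in \<open>auto simp: S_def\<close>)
    moreover have "exec \<phi> (While b (Seq (Dec b) c)) (S ?n) (S 0)"
    proof (rule exec_While_count[where S = S])
      show "exec \<phi> (Seq (Dec b) c) (S (Suc k)) (S k)" if "k < ?n" for k
      proof -
        have "?n - k = Suc (?n - Suc k)" using that by simp
        then show ?thesis
          using * by (intro exec_eq[OF exec_Seq[OF exec_Dec c]]) (auto simp: S_def fun_eq_iff)
      qed
    qed (simp add: S_def)
    moreover have "exec \<phi> (Move (b + 1) b) (S 0) (\<sigma>(b := (f ^^ ?n) ?y))"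
      by (rule exec_eq[OF exec_Move]) (use * in \<open>auto simp: S_def fun_eq_iff\<close>)
    ultimately show ?thesis
      by (blast intro: exec_Seq)
  qed
  then show ?case by blast
qed

section \<open>Running a given machine inside a larger one\<close>

text \<open>All states from \<open>N\<close> on mean halting; \<open>min\<close> merges them into
  \<open>p + N\<close>, so halting turns into falling through to the code placed after the
  copy.\<close>

fun relocate :: "nat \<Rightarrow> nat \<Rightarrow> nat \<Rightarrow> instr \<Rightarrow> instr" where
  "relocate p N k (Act \<delta>) =
     Act (\<lambda>as. (p + min (fst (\<delta> (take k as))) N, snd (\<delta> (take k as)) @ stay (drop k as)))"
| "relocate p N k (Query q) = Query (p + min q N)"

text \<open>Two invariants of a run: symbols stay in the alphabet, since only there well-formedness
  controls the transition functions; and supports stay finite, which guarantees that the output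
  block ends.\<close>

definition valid_tapes :: "machine \<Rightarrow> tape list \<Rightarrow> bool" where
  "valid_tapes M ts \<longleftrightarrow> length ts = num_tapes M \<and>
     (\<forall>t\<in>set ts. (\<forall>j. t j < num_symbols M) \<and> finite {j. t j \<noteq> 0})"

lemma finite_move_head:
  assumes "finite {j. t j \<noteq> 0}"
  shows "finite {j. move_head d t j \<noteq> 0}"
proof (cases d)
  case Move_Left
  have "finite ((\<lambda>j. j - 1) -` {j. t j \<noteq> 0})"
    using assms by (rule finite_vimageI) (simp add: inj_def)
  then show ?thesis using Move_Left by (simp add: vimage_def)
next
  case Move_Right
  have "finite ((\<lambda>j. j + 1) -` {j. t j \<noteq> 0})"
    using assms by (rule finite_vimageI) (simp add: inj_def)
  then show ?thesis using Move_Right by (simp add: vimage_def)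
qed (use assms in simp)

lemma valid_tapes_write:
  assumes "valid_tapes M ts" "length ws = num_tapes M" "fst ` set ws \<subseteq> {..<num_symbols M}"
  shows "valid_tapes M (map2 (\<lambda>t (a, d). move_head d (t(0 := a))) ts ws)"
proof -
  have "(\<forall>j. move_head d (t(0 := a)) j < num_symbols M) \<and> finite {j. move_head d (t(0 := a)) j \<noteq> 0}"
    if "(t, a, d) \<in> set (zip ts ws)" for t a d
  proof
    have t: "t \<in> set ts" and "(a, d) \<in> set ws"
      using that by (auto dest: set_zip_leftD set_zip_rightD)
    then have a: "a < num_symbols M"
      using assms(3) by force
    have "t j < num_symbols M" for j
      using assms(1) t by (simp add: valid_tapes_def)
    with a show "\<forall>j. move_head d (t(0 := a)) j < num_symbols M"
      by (cases d) auto
    have "finite (insert 0 {j. t j \<noteq> 0})"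
      using t assms(1) by (auto simp: valid_tapes_def)
    then have "finite {j. (t(0 := a)) j \<noteq> 0}"
      by (rule rev_finite_subset) auto
    then show "finite {j. move_head d (t(0 := a)) j \<noteq> 0}"
      by (rule finite_move_head)
  qed
  then show ?thesis
    using assms by (auto simp: valid_tapes_def)
qed

text \<open>The oracles on the two sides are unrelated because \<psi> never queries. The minima on
  both sides also cover a halted \<psi>, for which the larger machine makes no step.\<close>

lemma relocate_step:
  assumes \<psi>: "turing_machine \<psi>"
    and code: "code_at M p (map (relocate p (length (instrs \<psi>)) (num_tapes \<psi>)) (instrs \<psi>))"
    and us: "valid_tapes \<psi> us"
    and step: "step \<psi> \<phi>' (q, us) = (q', us')"
  shows "reaches M \<phi> (p + min q (length (instrs \<psi>)), us @ vs) (p + min q' (length (instrs \<psi>)), us' @ vs)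
    \<and> valid_tapes \<psi> us'"
proof (cases "q < length (instrs \<psi>)")
  case False
  then show ?thesis
    using step us by (auto simp: step_def halted_def reaches_refl)
next
  case True
  let ?k = "num_tapes \<psi>" and ?N = "length (instrs \<psi>)"
  have "instrs \<psi> ! q \<in> set (instrs \<psi>)"
    using True by simp
  then obtain \<delta> where \<delta>: "instrs \<psi> ! q = Act \<delta>" "Act \<delta> \<in> set (instrs \<psi>)"
    using \<psi> unfolding turing_machine_def by (metis instr.exhaust)
  define as where "as = map (\<lambda>t. t 0) us"
  define ws where "ws = snd (\<delta> as)"
  have as: "length as = ?k" "set as \<subseteq> {..<num_symbols \<psi>}"
    using us by (auto simp: as_def valid_tapes_def)
  have len: "length us = ?k"
    using us by (simp add: valid_tapes_def)
  have ws: "length ws = ?k" "fst ` set ws \<subseteq> {..<num_symbols \<psi>}"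
    using \<psi> \<delta>(2) as unfolding turing_machine_def oracle_turing_machine_def ws_def by blast+
  have q': "q' = fst (\<delta> as)" and us': "us' = map2 (\<lambda>t (a, d). move_head d (t(0 := a))) us ws"
    using step True \<delta>(1) by (auto simp: step_def halted_def as_def ws_def split: prod.splits)
  obtain xs ys where *: "instrs M = xs @ map (relocate p ?N ?k) (instrs \<psi>) @ ys" "length xs = p"
    using code unfolding code_at_def by blast
  have "map2 (\<lambda>t (a, d). move_head d (t(0 := a))) (us @ vs) (ws @ stay (map (\<lambda>t. t 0) vs)) = us' @ vs"
    using len ws(1) by (simp add: us' act_stay)
  then have "step M \<phi> (p + q, us @ vs) = (p + min q' ?N, us' @ vs)"
    using True * \<delta>(1) len as(1) by (simp add: step_def halted_def nth_append q' flip: as_def ws_def)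
  then have "reaches M \<phi> (p + min q ?N, us @ vs) (p + min q' ?N, us' @ vs)"
    using True by (simp add: reaches_step)
  then show ?thesis
    using valid_tapes_write[OF us ws] us' by simp
qed

lemma relocate_steps:
  assumes "turing_machine \<psi>"
    and "code_at M p (map (relocate p (length (instrs \<psi>)) (num_tapes \<psi>)) (instrs \<psi>))"
    and "valid_tapes \<psi> us"
    and "(step \<psi> \<phi>' ^^ T) (q, us) = (q', us')"
  shows "reaches M \<phi> (p + min q (length (instrs \<psi>)), us @ vs) (p + min q' (length (instrs \<psi>)), us' @ vs)
    \<and> valid_tapes \<psi> us'"
  using assms(4)
proof (induction T arbitrary: q' us')
  case 0
  then show ?case using assms(3) by (simp add: reaches_refl)
next
  case (Suc T)
  obtain q1 us1 where 1: "(step \<psi> \<phi>' ^^ T) (q, us) = (q1, us1)"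
    by fastforce
  then have "step \<psi> \<phi>' (q1, us1) = (q', us')"
    using Suc.prems by simp
  then show ?case
    using relocate_step[OF assms(1,2)] Suc.IH[OF 1] reaches_trans by blast
qed

text \<open>Finite support supplies the witness that the \<open>LEAST\<close> in
  \<open>read_num\<close> needs: the block of ones cannot be infinite.\<close>

lemma tape_holds_read_num:
  assumes "finite {j. t j \<noteq> 0}"
  shows "tape_holds False t (read_num t)"
proof -
  have "finite (int -` {j. t j \<noteq> 0})"
    using assms by (rule finite_vimageI) simp
  then obtain j where "j \<notin> int -` {j. t j \<noteq> 0}"
    using ex_new_if_finite infinite_UNIV_nat by blast
  then have "t (int j) \<noteq> 1"
    by simp
  then have "t (int (read_num t)) \<noteq> 1"
    unfolding read_num_def by (rule LeastI)
  moreover have "t (int j) = 1" if "j < read_num t" for j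
    using that not_less_Least unfolding read_num_def by blast
  ultimately show ?thesis
    by (simp add: tape_holds_def)
qed

lemma well_formed_relocate:
  assumes "well_formed_instr k s I" "k \<le> K"
  shows "well_formed_instr K s (relocate p N k I)"
proof (cases I)
  case (Act \<delta>)
  show ?thesis
    unfolding Act relocate.simps
  proof (rule well_formed_Act)
    fix as :: "nat list"
    assume as: "length as = K" "set as \<subseteq> {..<s}"
    have "length (take k as) = k" "set (take k as) \<subseteq> {..<s}" "set (drop k as) \<subseteq> {..<s}"
      using as assms(2) by (auto dest: in_set_takeD in_set_dropD)
    then have "length (snd (\<delta> (take k as))) = k" "fst ` set (snd (\<delta> (take k as))) \<subseteq> {..<s}"
      "fst ` set (stay (drop k as)) \<subseteq> {..<s}"
      using assms(1) unfolding Act well_formed_instr_def by (blast, blast, simp only: fst_stay)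
    then show "length (snd (p + min (fst (\<delta> (take k as))) N, snd (\<delta> (take k as)) @ stay (drop k as))) = K \<and>
        fst ` set (snd (p + min (fst (\<delta> (take k as))) N, snd (\<delta> (take k as)) @ stay (drop k as))) \<subseteq> {..<s}"
      using as assms(2) by (simp add: image_Un)
  qed
qed (simp add: well_formed_instr_def)

text \<open>Both approximations are requested at \<open>n + c\<close>; the constant \<open>c\<close>
  stands for the extra bits that will absorb the errors of the computation.\<close>

theorem oracle_machine_of_prec:
  assumes \<psi>: "turing_machine \<psi>" and G: "prec G"
  shows "\<exists>M. oracle_turing_machine M \<and>
    (\<forall>\<phi> n y. outputs \<psi> (n + c) y \<longrightarrow>
       oracle_outputs M \<phi> n (G (prod_encode (n, prod_encode (y, \<phi> (n + c))))))"
proof -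
  define k where "k = num_tapes \<psi>"
  define N where "N = length (instrs \<psi>)"
  have k: "2 \<le> k" and s: "2 \<le> num_symbols \<psi>"
    using \<psi> by (auto simp: k_def turing_machine_def oracle_turing_machine_def)
  obtain cG where cG: "\<And>\<phi> \<sigma>. \<forall>i>k. \<sigma> i = 0 \<Longrightarrow> exec \<phi> cG \<sigma> (\<sigma>(k := G (\<sigma> k)))"
    using prec_program[OF G] by metis
  \<comment> \<open>Tape \<open>k\<close> is the first one that the copy of \<psi> leaves alone, so
    n survives there.\<close>
  define c1 where "c1 = Seq (Copy 0 k (k + 1)) (Add_const 0 c)"
  \<comment> \<open>\<psi> may leave a number on tape 1, which is the query tape, hence the
    \<open>Clear\<close>. Registers \<open>k\<close>, \<open>k + 1\<close>, \<open>k + 2\<close>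
    come to hold n, y and the answer, in the order required by the two nested pairings.\<close>
  define c2 where "c2 = Seq (Move 0 (k + 1)) (Seq (Clear 1) (Seq (Copy k 1 (k + 2)) (Seq (Add_const 1 c)
    (Seq Ask (Seq (Move 1 (k + 2)) (Seq (Pair_regs (k + 1)) (Seq (Pair_regs k) (Seq cG
    (Seq (Clear 0) (Move k 0))))))))))"
  define p1 where "p1 = code_size c1"
  define p2 where "p2 = p1 + N"
  define K where "K = max k (max (reg_bound c1) (reg_bound c2))"
  define M where "M = \<lparr>num_tapes = K, num_symbols = num_symbols \<psi>,
    instrs = compile 0 c1 @ map (relocate p1 N k) (instrs \<psi>) @ compile p2 c2\<rparr>"
  have K: "k \<le> K" "reg_bound c1 \<le> K" "reg_bound c2 \<le> K"
    by (simp_all add: K_def)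
  have code: "code_at M 0 (compile 0 c1)" "code_at M p1 (map (relocate p1 N k) (instrs \<psi>))"
    "code_at M p2 (compile p2 c2)"
    by (auto simp: code_at_def M_def p1_def p2_def N_def
        intro: exI[of _ "[]"] exI[of _ "compile 0 c1"]
          exI[of _ "compile 0 c1 @ map (relocate p1 N k) (instrs \<psi>)"])
  have "oracle_turing_machine M"
    unfolding oracle_turing_machine_iff
  proof (intro conjI ballI)
    fix I assume "I \<in> set (instrs M)"
    then consider "I \<in> set (compile 0 c1)" | J where "J \<in> set (instrs \<psi>)" "I = relocate p1 N k J"
      | "I \<in> set (compile p2 c2)"
      by (auto simp: M_def)
    then show "well_formed_instr (num_tapes M) (num_symbols M) I"
    proof cases
      case 2
      have "well_formed_instr k (num_symbols \<psi>) J"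
        using \<psi> 2(1) unfolding turing_machine_def oracle_turing_machine_iff k_def by blast
      then show ?thesis
        using K(1) 2(2) well_formed_relocate by (simp add: M_def)
    qed (use K s well_formed_compile in \<open>auto simp: M_def\<close>)
  qed (use k K s in \<open>auto simp: M_def\<close>)
  moreover have "oracle_outputs M \<phi> n (G (prod_encode (n, prod_encode (y, \<phi> (n + c)))))"
    if halts: "outputs \<psi> (n + c) y" for \<phi> n y
  proof -
    obtain T q us where T: "(step \<psi> (\<lambda>_. 0) ^^ T) (start \<psi> (n + c)) = (q, us)"
      and q: "N \<le> q" and y: "read_num (us ! 0) = y"
      using halts unfolding outputs_def oracle_outputs_def halted_def N_def Let_def
      by (metis prod.collapse)
    define \<sigma>0 :: "nat \<Rightarrow> nat" where "\<sigma>0 = (\<lambda>_. 0)(0 := n)"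
    define \<sigma>1 :: "nat \<Rightarrow> nat" where "\<sigma>1 = (\<lambda>_. 0)(0 := n + c, k := n)"
    have "exec \<phi> (Copy 0 k (k + 1)) \<sigma>0 (\<sigma>0(k := n))"
      by (rule exec_eq[OF exec_Copy]) (use k in \<open>auto simp: \<sigma>0_def\<close>)
    moreover have "exec \<phi> (Add_const 0 c) (\<sigma>0(k := n)) \<sigma>1"
      by (rule exec_eq[OF exec_Add_const]) (use k in \<open>auto simp: \<sigma>0_def \<sigma>1_def fun_eq_iff\<close>)
    ultimately have exec1: "exec \<phi> c1 \<sigma>0 \<sigma>1"
      unfolding c1_def by (rule exec_Seq)
    have "tapes_hold True (snd (start M n)) \<sigma>0"
      using tape_holds_write_num by (auto simp: tapes_hold_def start_def \<sigma>0_def nth_Cons split: nat.splits)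
    moreover have "length (snd (start M n)) = K"
      using k K by (simp add: start_def M_def)
    ultimately obtain ts where ts: "reaches M \<phi> (0, snd (start M n)) (p1, ts)" "tapes_hold True ts \<sigma>1"
      "length ts = K"
      using compile_correct[OF exec1 code(1), of True "snd (start M n)" K] K(2) unfolding p1_def by auto
    define vs where "vs = drop k ts"
    \<comment> \<open>This is where exactness matters: \<psi> must start from precisely its own
      start configuration, not merely from tapes with the right blocks.\<close>
    have "take k ts = snd (start \<psi> (n + c))"
      by (rule nth_equalityI)
        (use ts(2,3) k K(1) in \<open>auto simp: start_def tapes_hold_def tape_holds_def \<sigma>1_def nth_Cons
           simp flip: k_def split: nat.splits\<close>)
    then have ts_eq: "ts = snd (start \<psi> (n + c)) @ vs"
      unfolding vs_def by (metis append_take_drop_id)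
    have valid: "valid_tapes \<psi> (snd (start \<psi> (n + c)))"
    proof -
      have "(\<forall>j. write_num m j < num_symbols \<psi>) \<and> finite {j. write_num m j \<noteq> 0}" for m
      proof -
        have "{j. write_num m j \<noteq> 0} \<subseteq> {0..<int m}"
          by (auto simp: write_num_def split: if_splits)
        then show ?thesis
          using s by (auto simp: write_num_def intro: finite_subset)
      qed
      then show ?thesis
        using k by (auto simp: valid_tapes_def start_def simp flip: k_def)
    qed
    have "reaches M \<phi> (p1 + min 0 N, snd (start \<psi> (n + c)) @ vs) (p1 + min q N, us @ vs) \<and> valid_tapes \<psi> us"
      unfolding N_def
      by (rule relocate_steps[OF \<psi> code(2)[unfolded N_def k_def] valid])
        (use T in \<open>simp add: start_def\<close>)
    then have reach2: "reaches M \<phi> (p1, ts) (p2, us @ vs)" and us: "valid_tapes \<psi> us"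
      using q by (simp_all add: ts_eq p2_def min_absorb2)
    have len: "length us = k"
      using us by (simp add: valid_tapes_def k_def)
    \<comment> \<open>Registers 2 to k - 1 keep whatever \<psi> left there; \<open>cG\<close> is
      correct for arbitrary contents below \<open>k\<close>.\<close>
    define \<sigma>2 where "\<sigma>2 i = (if i < k then read_num (us ! i) else \<sigma>1 i)" for i
    have "tapes_hold False (us @ vs) \<sigma>2"
      unfolding tapes_hold_def
    proof (intro allI impI)
      fix i assume i: "i < length (us @ vs)"
      show "tape_holds False ((us @ vs) ! i) (\<sigma>2 i)"
      proof (cases "i < k")
        case True
        then have "us ! i \<in> set us"
          using len by simp
        then have "tape_holds False (us ! i) (read_num (us ! i))"
          using us tape_holds_read_num by (simp add: valid_tapes_def)
        then show ?thesis
          using True len by (simp add: \<sigma>2_def nth_append)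
      next
        case False
        then have "(us @ vs) ! i = ts ! i"
          using i len ts(3) by (simp add: nth_append vs_def)
        moreover have "tape_holds True (ts ! i) (\<sigma>1 i)"
          using i ts(2,3) len K(1) by (auto simp: tapes_hold_def vs_def)
        ultimately show ?thesis
          using False unfolding \<sigma>2_def tape_holds_def by metis
      qed
    qed
    moreover have "length (us @ vs) = K"
      using len ts(3) K(1) by (simp add: vs_def)
    moreover define z where "z = G (prod_encode (n, prod_encode (y, \<phi> (n + c))))"
    moreover have "\<exists>\<tau>. exec \<phi> c2 \<sigma>2 \<tau> \<and> \<tau> 0 = z"
    proof -
      define \<rho> where "\<rho> = \<sigma>2(0 := 0, 1 := 0)"
      have \<sigma>2: "\<sigma>2 0 = y" "\<sigma>2 k = n" "\<forall>i>k. \<sigma>2 i = 0"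
        using k y by (auto simp: \<sigma>2_def \<sigma>1_def)
      have \<rho>: "\<rho> 0 = 0" "\<rho> 1 = 0" "\<rho> k = n" "\<forall>i>k. \<rho> i = 0"
        using k \<sigma>2 by (auto simp: \<rho>_def)
      have "exec \<phi> (Move 0 (k + 1)) \<sigma>2 (\<sigma>2(0 := 0, k + 1 := y))"
        by (rule exec_eq[OF exec_Move]) (use \<sigma>2 in auto)
      moreover have "exec \<phi> (Clear 1) (\<sigma>2(0 := 0, k + 1 := y)) (\<rho>(k + 1 := y))"
        by (rule exec_eq[OF exec_Clear]) (use k in \<open>auto simp: \<rho>_def fun_eq_iff\<close>)
      moreover have "exec \<phi> (Copy k 1 (k + 2)) (\<rho>(k + 1 := y)) (\<rho>(k + 1 := y, 1 := n))"
        by (rule exec_eq[OF exec_Copy]) (use k \<rho> in auto)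
      moreover have "exec \<phi> (Add_const 1 c) (\<rho>(k + 1 := y, 1 := n)) (\<rho>(k + 1 := y, 1 := n + c))"
        by (rule exec_eq[OF exec_Add_const]) auto
      moreover have "exec \<phi> Ask (\<rho>(k + 1 := y, 1 := n + c)) (\<rho>(k + 1 := y, 1 := \<phi> (n + c)))"
        by (rule exec_eq[OF exec_Ask]) auto
      moreover have "exec \<phi> (Move 1 (k + 2)) (\<rho>(k + 1 := y, 1 := \<phi> (n + c)))
          (\<rho>(k + 1 := y, k + 2 := \<phi> (n + c)))"
        by (rule exec_eq[OF exec_Move]) (use k \<rho> in \<open>auto simp: fun_eq_iff\<close>)
      moreover have "exec \<phi> (Pair_regs (k + 1)) (\<rho>(k + 1 := y, k + 2 := \<phi> (n + c)))
          (\<rho>(k + 1 := prod_encode (y, \<phi> (n + c))))"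
        by (rule exec_eq[OF exec_Pair_regs]) (use k \<rho> in \<open>auto simp: fun_eq_iff\<close>)
      moreover have "exec \<phi> (Pair_regs k) (\<rho>(k + 1 := prod_encode (y, \<phi> (n + c))))
          (\<rho>(k := prod_encode (n, prod_encode (y, \<phi> (n + c)))))"
        by (rule exec_eq[OF exec_Pair_regs]) (use k \<rho> in \<open>auto simp: fun_eq_iff\<close>)
      moreover have "exec \<phi> cG (\<rho>(k := prod_encode (n, prod_encode (y, \<phi> (n + c))))) (\<rho>(k := z))"
        by (rule exec_eq[OF cG]) (use \<rho> in \<open>auto simp: z_def\<close>)
      moreover have "exec \<phi> (Clear 0) (\<rho>(k := z)) (\<rho>(k := z))"
        by (rule exec_eq[OF exec_Clear]) (use k \<rho> in \<open>auto simp: fun_eq_iff\<close>)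
      moreover have "exec \<phi> (Move k 0) (\<rho>(k := z)) (\<rho>(k := 0, 0 := z))"
        by (rule exec_eq[OF exec_Move]) (use k \<rho> in \<open>auto simp: fun_eq_iff\<close>)
      ultimately have "exec \<phi> c2 \<sigma>2 (\<rho>(k := 0, 0 := z))"
        unfolding c2_def by (blast intro: exec_Seq)
      then show ?thesis
        using k by force
    qed
    ultimately obtain \<tau> ts' where "reaches M \<phi> (p2, us @ vs) (p2 + code_size c2, ts')"
      "tapes_hold False ts' \<tau>" "length ts' = K" "\<tau> 0 = z"
      using compile_correct[OF _ code(3)] K(3) by metis
    note ts' = this
    have "reaches M \<phi> (start M n) (p2 + code_size c2, ts')"
      using reaches_trans[OF ts(1) reaches_trans[OF reach2 ts'(1)]] by (simp add: start_def)
    then obtain U where "(step M \<phi> ^^ U) (start M n) = (p2 + code_size c2, ts')"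
      unfolding reaches_def by blast
    moreover have "halted M (p2 + code_size c2, ts')"
      by (simp add: halted_def M_def p1_def p2_def N_def)
    moreover have "tape_holds False (ts' ! 0) (\<tau> 0)"
      using ts'(2,3) k K(1) by (simp add: tapes_hold_def)
    then have "read_num (ts' ! 0) = z"
      using ts'(4) read_num_tape_holds by metis
    ultimately show ?thesis
      unfolding oracle_outputs_def z_def by (metis snd_conv)
  qed
  ultimately show ?thesis by blast
qed

section \<open>Closure properties of primitive recursive functions\<close>

lemma prec_Suc': "prec f \<Longrightarrow> prec (\<lambda>x. Suc (f x))"
  by (rule prec_comp[OF prec_Suc])

lemma prec_id: "prec (\<lambda>x. x)"
  using prec_comp[OF prec_pred prec_Suc] by simp

lemma prec_const: "prec (\<lambda>_. k)"
  by (induction k) (simp_all add: prec_zero prec_Suc')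

lemma prec_pred': "prec f \<Longrightarrow> prec (\<lambda>x. f x - Suc 0)"
  using prec_comp[OF prec_pred] by simp

lemma prec_pfst': "prec f \<Longrightarrow> prec (\<lambda>x. pfst (f x))"
  by (rule prec_comp[OF prec_pfst])

lemma prec_psnd': "prec f \<Longrightarrow> prec (\<lambda>x. psnd (f x))"
  by (rule prec_comp[OF prec_psnd])

text \<open>Binary functions enter as unary functions of a pair. This form, shared by the rules
  below, lets \<open>intro\<close> decompose nested terms.\<close>

lemma prec_comp2:
  assumes "prec (\<lambda>p. h (pfst p) (psnd p))" "prec f" "prec g"
  shows "prec (\<lambda>x. h (f x) (g x))"
  using prec_comp[OF assms(1) prec_pair[OF assms(2,3)]] by simp

text \<open>The constructor iterates a function without parameters. Here x is carried along
  unchanged in the first component of the iterated pair.\<close>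

lemma prec_funpow':
  assumes h: "prec (\<lambda>p. h (pfst p) (psnd p))" and n: "prec n" and a: "prec a"
  shows "prec (\<lambda>x. (h x ^^ n x) (a x))"
proof -
  define F where "F p = prod_encode (pfst p, h (pfst p) (psnd p))" for p
  have "prec F"
    unfolding F_def by (intro prec_pair prec_pfst h)
  have F: "(F ^^ k) (prod_encode (x, y)) = prod_encode (x, (h x ^^ k) y)" for k x y
    by (induction k) (simp_all add: F_def)
  have "prec (\<lambda>x. psnd ((\<lambda>z. (F ^^ pfst z) (psnd z)) (prod_encode (n x, prod_encode (x, a x)))))"
    by (intro prec_psnd' prec_comp[OF prec_funpow[OF \<open>prec F\<close>]] prec_pair n prec_id a)
  then show ?thesis
    by (simp add: F)
qed

lemma prec_add:
  assumes "prec f" "prec g"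
  shows "prec (\<lambda>x. f x + g x)"
proof -
  have "prec (\<lambda>x. (Suc ^^ f x) (g x))"
    using assms by (intro prec_funpow' prec_Suc' prec_psnd)
  moreover have "(Suc ^^ k) y = k + y" for k y
    by (induction k) simp_all
  ultimately show ?thesis by simp
qed

lemma prec_diff:
  assumes "prec f" "prec g"
  shows "prec (\<lambda>x. f x - g x)"
proof -
  have "prec (\<lambda>x. ((\<lambda>y. y - Suc 0) ^^ g x) (f x))"
    using assms by (intro prec_funpow' prec_pred' prec_psnd)
  moreover have "((\<lambda>y. y - Suc 0) ^^ k) y = y - k" for k y
    by (induction k) simp_all
  ultimately show ?thesis by simp
qed

lemma prec_sum:
  assumes h: "prec (\<lambda>p. h (pfst p) (psnd p))" and n: "prec n"
  shows "prec (\<lambda>x. \<Sum>i<n x. h x i)"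
proof -
  define F where "F x s = prod_encode (Suc (pfst s), psnd s + h x (pfst s))" for x s
  have "prec (\<lambda>p. F (pfst p) (psnd p))"
    unfolding F_def
    by (intro prec_pair prec_Suc' prec_add prec_comp2[OF h] prec_pfst' prec_psnd' prec_id)
  then have "prec (\<lambda>x. psnd ((F x ^^ n x) (prod_encode (0, 0))))"
    by (intro prec_psnd' prec_funpow' n prec_const)
  moreover have "(F x ^^ k) (prod_encode (0, 0)) = prod_encode (k, \<Sum>i<k. h x i)" for x k
    by (induction k) (simp_all add: F_def)
  ultimately show ?thesis by simp
qed

lemma prec_mult: "prec f \<Longrightarrow> prec g \<Longrightarrow> prec (\<lambda>x. f x * g x)"
  using prec_sum[of "\<lambda>x _. g x" f] prec_comp[OF _ prec_pfst, of g] by simp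

lemma prec_power2:
  assumes "prec f"
  shows "prec (\<lambda>x. 2 ^ f x)"
proof -
  have "prec (\<lambda>x. ((\<lambda>y. y + y) ^^ f x) 1)"
    using assms by (intro prec_funpow' prec_add prec_psnd prec_const)
  moreover have "((\<lambda>y. y + y) ^^ k) 1 = (2 :: nat) ^ k" for k
    by (induction k) simp_all
  ultimately show ?thesis by simp
qed

definition precp :: "(nat \<Rightarrow> bool) \<Rightarrow> bool" where
  "precp P \<longleftrightarrow> prec (\<lambda>x. of_bool (P x))"

lemma prec_if:
  assumes "precp P" "prec f" "prec g"
  shows "prec (\<lambda>x. if P x then f x else g x)"
proof -
  have "prec (\<lambda>x. of_bool (P x) * f x + (1 - of_bool (P x)) * g x)"
    using assms unfolding precp_def by (intro prec_add prec_mult prec_diff prec_const)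
  then show ?thesis
    by (rule back_subst[of prec]) auto
qed

lemma precp_le:
  assumes "prec f" "prec g"
  shows "precp (\<lambda>x. f x \<le> g x)"
proof -
  have "prec (\<lambda>x. 1 - (f x - g x))"
    using assms by (intro prec_diff prec_const)
  then show ?thesis
    unfolding precp_def by (rule back_subst[of prec]) auto
qed

lemma precp_not:
  assumes "precp P"
  shows "precp (\<lambda>x. \<not> P x)"
proof -
  have "prec (\<lambda>x. 1 - of_bool (P x))"
    using assms unfolding precp_def by (intro prec_diff prec_const)
  then show ?thesis
    unfolding precp_def by (rule back_subst[of prec]) auto
qed

lemma precp_conj:
  assumes "precp P" "precp Q"
  shows "precp (\<lambda>x. P x \<and> Q x)"
proof -
  have "prec (\<lambda>x. of_bool (P x) * of_bool (Q x))"
    using assms unfolding precp_def by (intro prec_mult)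
  then show ?thesis
    unfolding precp_def by (rule back_subst[of prec]) auto
qed

lemma precp_less:
  assumes "prec f" "prec g"
  shows "precp (\<lambda>x. f x < g x)"
  using precp_not[OF precp_le[OF assms(2,1)]] by (simp add: not_le)

lemma precp_ex:
  assumes "precp (\<lambda>p. P (pfst p) (psnd p))" "prec n"
  shows "precp (\<lambda>x. \<exists>i<n x. P x i)"
proof -
  have "precp (\<lambda>x. 0 < (\<Sum>i<n x. of_bool (P x i) :: nat))"
    using assms(1) unfolding precp_def[of "\<lambda>p. P (pfst p) (psnd p)"]
    by (intro precp_less prec_sum prec_const assms(2))
  moreover have "0 < (\<Sum>i<k. of_bool (P x i) :: nat) \<longleftrightarrow> (\<exists>i<k. P x i)" for x k
    by (auto simp: sum_eq_0_iff simp flip: neq0_conv)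
  ultimately show ?thesis by simp
qed

lemma precp_all:
  assumes "precp (\<lambda>p. P (pfst p) (psnd p))" "prec n"
  shows "precp (\<lambda>x. \<forall>i<n x. P x i)"
  using precp_not[OF precp_ex[OF precp_not[OF assms(1)] assms(2)]] by simp

text \<open>For b > 0, the quotient of a by b counts the k < a with (k + 1) b \<le> a and is
  therefore a bounded sum; for b = 0 the value 0 agrees with the convention for
  \<open>div\<close>.\<close>

lemma prec_div:
  assumes "prec f" "prec g"
  shows "prec (\<lambda>x. f x div g x)"
proof -
  have "precp (\<lambda>p. Suc (psnd p) * g (pfst p) \<le> f (pfst p))"
    by (intro precp_le prec_mult prec_Suc' prec_psnd prec_comp[OF assms(1) prec_pfst]
        prec_comp[OF assms(2) prec_pfst])
  then have "prec (\<lambda>x. if 0 < g x then \<Sum>k<f x. of_bool (Suc k * g x \<le> f x) else 0)"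
    using assms unfolding precp_def by (intro prec_if precp_less prec_sum prec_const)
  moreover have "(\<Sum>k<a. of_bool (Suc k * b \<le> a)) = a div b" if "0 < b" for a b :: nat
  proof -
    have "{k. k < a \<and> Suc k * b \<le> a} = {..<a div b}"
    proof -
      have "Suc k * b \<le> a \<longleftrightarrow> k < a div b" for k
        using less_eq_div_iff_mult_less_eq[OF that, of "Suc k" a] by (simp add: Suc_le_eq)
      moreover have "k < a" if "k < a div b" for k
        using that div_le_dividend by (rule less_le_trans)
      ultimately show ?thesis
        by blast
    qed
    then show ?thesis
      by (simp add: sum.If_cases of_bool_def Collect_conj_eq lessThan_def)
  qed
  ultimately have "prec (\<lambda>x. if 0 < g x then f x div g x else 0)"
    by (simp cong: if_cong)
  then show ?thesis
    by (rule back_subst[of prec]) auto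
qed

section \<open>Codes of lists and rationals\<close>

text \<open>The code of a nonempty list is the successor of the pair of its head and the code of its
  tail, so decrementing and projecting removes the head. The empty list, coded by 0, is a fixed
  point.\<close>

definition ndrop :: "nat \<Rightarrow> nat \<Rightarrow> nat" where
  "ndrop c i = ((\<lambda>z. psnd (z - Suc 0)) ^^ i) c"

definition nnth :: "nat \<Rightarrow> nat \<Rightarrow> nat" where
  "nnth c i = pfst (ndrop c i - Suc 0)"

lemma ndrop_list_encode: "ndrop (list_encode xs) i = list_encode (drop i xs)"
proof (induction i arbitrary: xs)
  case (Suc i)
  have "psnd (list_encode xs - Suc 0) = list_encode (tl xs)"
  proof (cases xs)
    case Nil
    then show ?thesis
      using psnd_prod_encode[of 0 0] by (simp add: prod_encode_def)
  qed simp
  then show ?case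
    using Suc[of "tl xs"] by (simp add: ndrop_def funpow_Suc_right drop_Suc del: funpow.simps)
qed (simp add: ndrop_def)

lemma nnth_list_encode: "i < length xs \<Longrightarrow> nnth (list_encode xs) i = xs ! i"
  by (simp add: nnth_def ndrop_list_encode Cons_nth_drop_Suc[symmetric])

lemma ndrop_nonzero_iff: "0 < ndrop (list_encode xs) i \<longleftrightarrow> i < length xs"
  by (cases "i < length xs") (simp_all add: ndrop_list_encode Cons_nth_drop_Suc[symmetric])

text \<open>Lets the code itself bound the search for a position, so that no length has to be
  computed.\<close>

lemma length_le_list_encode: "length xs \<le> list_encode xs"
proof (induction xs)
  case (Cons x xs)
  then show ?case
    using le_prod_encode_2[of "list_encode xs" x] by simp
qed simp

lemma prec_ndrop: "prec f \<Longrightarrow> prec g \<Longrightarrow> prec (\<lambda>x. ndrop (f x) (g x))"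
  unfolding ndrop_def by (intro prec_funpow' prec_psnd' prec_pred' prec_id)

lemma prec_nnth: "prec f \<Longrightarrow> prec g \<Longrightarrow> prec (\<lambda>x. nnth (f x) (g x))"
  unfolding nnth_def by (intro prec_pfst' prec_pred' prec_ndrop)

text \<open>\<open>int_encode\<close> maps \<open>i \<ge> 0\<close> to \<open>2 i\<close> and \<open>i < 0\<close> to \<open>- 2 i - 1\<close>.\<close>

definition scaled :: "nat \<Rightarrow> nat \<Rightarrow> nat \<Rightarrow> nat" where
  "scaled D Z r = (let a = pfst r; b = psnd r in
     if 2 * (a div 2) < a then Z - D * (Suc a div 2) div b else Z + D * (a div 2) div b)"

lemma prec_scaled: "prec f \<Longrightarrow> prec g \<Longrightarrow> prec h \<Longrightarrow> prec (\<lambda>x. scaled (f x) (g x) (h x))"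
  unfolding scaled_def Let_def
  by (intro prec_if precp_less prec_diff prec_add prec_mult prec_div prec_const prec_Suc' prec_pfst' prec_psnd')

text \<open>The hypothesis prevents the subtraction from Z from being cut off at 0. The error is
  that of one integer division, which rounds the absolute value down.\<close>

lemma scaled_rat_code:
  assumes "\<bar>real D * of_rat q\<bar> \<le> real Z"
  shows "\<bar>real (scaled D Z (rat_code q)) - real Z - real D * of_rat q\<bar> \<le> 1"
proof -
  obtain i b where ib: "quotient_of q = (i, b)" by fastforce
  then have b: "0 < b" and q: "q = Fract i b"
    using quotient_of_denom_pos[of q] Fract_quotient_of[of q] ib by auto
  define d where "d = nat b"
  define a where "a = nat \<bar>i\<bar>"
  have d: "0 < d" "real_of_int b = real d"
    using b by (auto simp: d_def)
  have floor: "real (D * a div d) \<le> real (D * a) / real d" "real (D * a) / real d < real (D * a div d) + 1"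
    using floor_correct[of "real (D * a) / real d"]
    unfolding floor_divide_of_nat_eq[of "D * a" d, where ?'a = real] by simp_all
  have code: "rat_code q = prod_encode (int_encode i, d)"
    by (simp add: rat_code_def ib d_def)
  show ?thesis
  proof (cases "0 \<le> i")
    case True
    then have "real_of_int i = real a" "int_encode i = 2 * a"
      by (auto simp: a_def int_encode_def sum_encode_def)
    then have "scaled D Z (rat_code q) = Z + D * a div d" "real D * of_rat q = real (D * a) / real d"
      using d by (simp_all add: scaled_def code Let_def) (simp add: q of_rat_rat)
    then show ?thesis
      using floor by simp
  next
    case False
    then have "real_of_int i = - real a" "int_encode i = 2 * (a - 1) + 1" "0 < a"
      by (auto simp: a_def int_encode_def sum_encode_def nat_diff_distrib')
    then have *: "scaled D Z (rat_code q) = Z - D * a div d" "real D * of_rat q = - (real (D * a) / real d)"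
      using d by (simp_all add: scaled_def code Let_def) (simp add: q of_rat_rat)
    then have "real (D * a div d) \<le> real Z"
      using floor assms by simp
    then have "real (scaled D Z (rat_code q)) = real Z - real (D * a div d)"
      using * by simp
    then show ?thesis
      using floor * by simp
  qed
qed

section \<open>Bounded search over vectors\<close>

text \<open>The dimension is a fixed number, so the m nested bounded quantifiers are unfolded
  outside the primitive recursive functions. The last argument is the code of the list built so
  far.\<close>

primrec all_lists :: "nat \<Rightarrow> nat \<Rightarrow> (nat \<Rightarrow> bool) \<Rightarrow> nat \<Rightarrow> bool" where
  "all_lists 0 K T l = T l"
| "all_lists (Suc m) K T l = (\<forall>a<K. all_lists m K T (Suc (prod_encode (a, l))))"

lemma all_lists_iff:
  "all_lists m K T (list_encode l) \<longleftrightarrow>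
     (\<forall>as. length as = m \<longrightarrow> set as \<subseteq> {..<K} \<longrightarrow> T (list_encode (as @ l)))"
proof (induction m arbitrary: l)
  case (Suc m)
  have "all_lists (Suc m) K T (list_encode l) \<longleftrightarrow> (\<forall>a<K. all_lists m K T (list_encode (a # l)))"
    by simp
  also have "\<dots> \<longleftrightarrow> (\<forall>a<K. \<forall>as. length as = m \<longrightarrow> set as \<subseteq> {..<K} \<longrightarrow> T (list_encode (as @ a # l)))"
    by (simp only: Suc)
  also have "\<dots> \<longleftrightarrow> (\<forall>as. length as = Suc m \<longrightarrow> set as \<subseteq> {..<K} \<longrightarrow> T (list_encode (as @ l)))"
    (is "?L \<longleftrightarrow> ?R")
  proof
    assume L: ?L
    show ?R
    proof (intro allI impI)
      fix as assume as: "length as = Suc m" "set as \<subseteq> {..<K}"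
      \<comment> \<open>The outermost quantifier conses its value first, so that value is the last
        entry of \<open>as\<close>.\<close>
      then obtain bs a where "as = bs @ [a]"
        by (metis length_Suc_conv_rev)
      then show "T (list_encode (as @ l))"
        using L as by auto
    qed
  next
    assume R: ?R
    show ?L
    proof (intro allI impI)
      fix a as assume "a < K" "length as = m" "set as \<subseteq> {..<K}"
      then show "T (list_encode (as @ a # l))"
        using R[rule_format, of "as @ [a]"] by simp
    qed
  qed
  finally show ?case .
qed simp

text \<open>Each quantified value joins the parameter, which grows from x to a pair (x, a); hence
  the generalisation over \<open>T\<close>, \<open>K\<close> and \<open>l\<close>.\<close>

lemma precp_all_lists:
  assumes "precp (\<lambda>p. T (pfst p) (psnd p))" "prec K" "prec l"
  shows "precp (\<lambda>x. all_lists m (K x) (T x) (l x))"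
  using assms
proof (induction m arbitrary: T K l)
  case 0
  then show ?case
    unfolding precp_def by (simp add: prec_comp2[of "\<lambda>a b. of_bool (T a b)", OF _ prec_id])
next
  case (Suc m)
  have "prec (\<lambda>p. of_bool (T (pfst (pfst p)) (psnd p)))"
    using Suc.prems(1) unfolding precp_def
    by (rule prec_comp2[where h = "\<lambda>a b. of_bool (T a b)"]) (intro prec_pfst' prec_psnd' prec_id)+
  then have "precp (\<lambda>p. all_lists m (K (pfst p)) (T (pfst p)) (Suc (prod_encode (psnd p, l (pfst p)))))"
    using Suc.prems(2,3)
    by (intro Suc.IH) (auto simp: precp_def intro!: prec_Suc' prec_pair prec_psnd
        intro: prec_comp[OF _ prec_pfst])
  then show ?case
    using precp_all[of "\<lambda>x a. all_lists m (K x) (T x) (Suc (prod_encode (a, l x)))" K] Suc.prems(2)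
    by simp
qed

text \<open>A counter that stops at the first failure replaces unbounded minimisation, which is not
  primitive recursive. The case t = N has to be excluded by the caller.\<close>

lemma funpow_search:
  fixes P :: "nat \<Rightarrow> bool" and N :: nat
  defines "t \<equiv> ((\<lambda>t. if P t then Suc t else t) ^^ N) 0"
  shows "(\<forall>i<t. P i) \<and> (t = N \<or> \<not> P t)"
  unfolding t_def by (induction N) (auto simp: less_Suc_eq)

section \<open>Rotation sets\<close>

text \<open>The convex combination of \<mu> and \<nu> is realised as a two-stage experiment: a
  biased coin selects the measure. Its mass and integrals then follow from those of
  \<open>bind\<close>.\<close>

lemma invariant_prob_mixture:
  fixes f :: "'x::topological_space \<Rightarrow> 'x" and a :: real
  assumes \<mu>: "invariant_prob f \<mu>" and \<nu>: "invariant_prob f \<nu>" and a: "0 \<le> a" "a \<le> 1"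
  shows "\<exists>\<rho>. invariant_prob f \<rho> \<and>
    (\<forall>g. g \<in> borel_measurable borel \<longrightarrow> (\<exists>B. \<forall>x. \<bar>g x\<bar> \<le> B) \<longrightarrow>
       (\<integral>x. g x \<partial>\<rho>) = a * (\<integral>x. g x \<partial>\<mu>) + (1 - a) * (\<integral>x. (g x :: real) \<partial>\<nu>))"
proof -
  let ?p = "measure_pmf (bernoulli_pmf a)" and ?k = "\<lambda>b. if b then \<mu> else \<nu>"
  define \<rho> where "\<rho> = ?p \<bind> ?k"
  have sets: "sets (?k b) = sets borel" and prob: "prob_space (?k b)" for b
    using \<mu> \<nu> by (auto simp: invariant_prob_def)
  have k: "?k \<in> measurable ?p (subprob_algebra borel)"
    using sets prob by (auto simp: space_subprob_algebra prob_space_imp_subprob_space)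
  have sets_\<rho>: "sets \<rho> = sets borel"
    unfolding \<rho>_def by (intro sets_bind sets) auto
  \<comment> \<open>Invariance needs this for the preimage of A under f, which is not known to be
    Borel here; off the Borel sets both sides are 0.\<close>
  have emeasure_\<rho>: "emeasure \<rho> X = (\<integral>\<^sup>+b. emeasure (?k b) X \<partial>?p)" for X
  proof (cases "X \<in> sets borel")
    case True
    then show ?thesis
      unfolding \<rho>_def using k by (intro emeasure_bind) auto
  next
    case False
    then have "emeasure (?k b) X = 0" "emeasure \<rho> X = 0" for b
      using sets[of b] sets_\<rho> emeasure_notin_sets by blast+
    then show ?thesis by simp
  qed
  have "prob_space \<rho>"
    unfolding \<rho>_def by (intro measure_pmf.prob_space_bind[OF _ k] AE_I2 prob)
  moreover have "emeasure \<rho> (f -` A) = emeasure \<rho> A" if "A \<in> sets borel" for A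
    unfolding emeasure_\<rho>
    by (rule nn_integral_cong) (use that \<mu> \<nu> in \<open>auto simp: invariant_prob_def\<close>)
  ultimately have "invariant_prob f \<rho>"
    using sets_\<rho> by (simp add: invariant_prob_def)
  moreover have "(\<integral>x. g x \<partial>\<rho>) = a * (\<integral>x. g x \<partial>\<mu>) + (1 - a) * (\<integral>x. g x \<partial>\<nu>)"
    if "g \<in> borel_measurable borel" "\<And>x. \<bar>g x\<bar> \<le> B" for g :: "'x \<Rightarrow> real" and B
  proof -
    have "(\<integral>x. g x \<partial>\<rho>) = (\<integral>b. \<integral>x. g x \<partial>?k b \<partial>?p)"
      unfolding \<rho>_def
      by (rule integral_bind[OF that(1), where B' = 1 and B = B])
        (use that k prob in \<open>auto simp: measure_pmf.finite_measure_axioms prob_space.emeasure_space_1\<close>)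
    then show ?thesis
      using a by simp
  qed
  ultimately show ?thesis
    by blast
qed

lemma convex_Rot:
  fixes f :: "'x::metric_space \<Rightarrow> 'x" and \<Phi> :: "'x \<Rightarrow> real ^ 'm"
  assumes "compact (UNIV :: 'x set)" "continuous_on UNIV \<Phi>"
  shows "convex (Rot f \<Phi>)"
proof (rule convexI)
  fix x y and s t :: real
  assume "x \<in> Rot f \<Phi>" "y \<in> Rot f \<Phi>" and st: "0 \<le> s" "0 \<le> t" "s + t = 1"
  then obtain \<mu> \<nu> where \<mu>: "invariant_prob f \<mu>" "x = (\<chi> i. \<integral>z. \<Phi> z $ i \<partial>\<mu>)"
    and \<nu>: "invariant_prob f \<nu>" "y = (\<chi> i. \<integral>z. \<Phi> z $ i \<partial>\<nu>)"
    unfolding Rot_def by blast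
  have s: "s \<le> 1" "t = 1 - s" using st by auto
  obtain \<rho> where \<rho>: "invariant_prob f \<rho>" "\<And>g. g \<in> borel_measurable borel \<Longrightarrow> (\<exists>B. \<forall>x. \<bar>g x\<bar> \<le> B) \<Longrightarrow>
       (\<integral>x. g x \<partial>\<rho>) = s * (\<integral>x. g x \<partial>\<mu>) + (1 - s) * (\<integral>x. (g x :: real) \<partial>\<nu>)"
    using invariant_prob_mixture[OF \<mu>(1) \<nu>(1) st(1) s(1)] by blast
  have "bounded (range \<Phi>)"
    using assms by (intro compact_imp_bounded compact_continuous_image)
  then obtain B where B: "norm (\<Phi> z) \<le> B" for z
    unfolding bounded_iff by blast
  have "\<bar>\<Phi> z $ i\<bar> \<le> B" for z i
    using B[of z] component_le_norm_cart[of "\<Phi> z" i] by linarith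
  moreover have "(\<lambda>z. \<Phi> z $ i) \<in> borel_measurable borel" for i
    by (intro borel_measurable_continuous_onI continuous_on_component assms)
  ultimately have "(\<integral>z. \<Phi> z $ i \<partial>\<rho>) = s * (\<integral>z. \<Phi> z $ i \<partial>\<mu>) + (1 - s) * (\<integral>z. \<Phi> z $ i \<partial>\<nu>)" for i
    by (intro \<rho>(2)) blast+
  then have "s *\<^sub>R x + t *\<^sub>R y = (\<chi> i. \<integral>z. \<Phi> z $ i \<partial>\<rho>)"
    by (simp add: \<mu>(2) \<nu>(2) s(2) vec_eq_iff)
  then show "s *\<^sub>R x + t *\<^sub>R y \<in> Rot f \<Phi>"
    using \<rho>(1) unfolding Rot_def by blast
qed

section \<open>Largest balls in convex bodies\<close>

text \<open>\<open>GREATEST\<close> requires an attained maximum: the open ball of radius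
  \<open>Sup S\<close> is exhausted by the balls of smaller radii, so it still lies in U.\<close>

lemma largest_radius:
  fixes w :: "'a::euclidean_space"
  assumes "bounded U" "open U" "w \<in> U"
  shows "0 < largest_radius U w" "ball w (largest_radius U w) \<subseteq> U"
    and "\<And>\<rho>. 0 < \<rho> \<Longrightarrow> ball w \<rho> \<subseteq> U \<Longrightarrow> \<rho> \<le> largest_radius U w"
proof -
  define S where "S = {\<rho>. 0 < \<rho> \<and> ball w \<rho> \<subseteq> U}"
  obtain e where e: "e \<in> S"
    using assms(2,3) unfolding S_def open_contains_ball by auto
  obtain R where "U \<subseteq> cball w R"
    using bounded_subset_ballD[OF assms(1)] ball_subset_cball by blast
  then have "\<rho> \<le> R" if "\<rho> \<in> S" for \<rho>
    using that ball_subset_cball_iff[of w \<rho> w R] unfolding S_def by auto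
  then have bdd: "bdd_above S"
    by (meson bdd_aboveI)
  have upper: "\<rho> \<le> Sup S" if "\<rho> \<in> S" for \<rho>
    using that bdd by (rule cSup_upper)
  have "ball w (Sup S) \<subseteq> U"
  proof
    fix y assume "y \<in> ball w (Sup S)"
    then have "dist w y < Sup S" by simp
    then obtain \<rho> where "\<rho> \<in> S" "dist w y < \<rho>"
      using less_cSup_iff[OF _ bdd] e by blast
    then show "y \<in> U"
      unfolding S_def by auto
  qed
  moreover have "0 < Sup S"
    using upper[OF e] e unfolding S_def by simp
  ultimately have "largest_radius U w = Sup S"
    unfolding largest_radius_def
    by (intro Greatest_equality) (use upper in \<open>auto simp: S_def\<close>)
  with \<open>0 < Sup S\<close> \<open>ball w (Sup S) \<subseteq> U\<close> upper
  show "0 < largest_radius U w" "ball w (largest_radius U w) \<subseteq> U"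
    "\<And>\<rho>. 0 < \<rho> \<Longrightarrow> ball w \<rho> \<subseteq> U \<Longrightarrow> \<rho> \<le> largest_radius U w"
    by (simp_all add: S_def)
qed

text \<open>A point y of the ball outside the closure of K would be separated from K by a hyperplane
  with unit normal u. But some p in P exceeds w by s in direction u, and a point of K lies within e
  of p, hence beyond y. For convex K, passing to the closure does not enlarge the interior.\<close>

lemma ball_subset_interior_convex:
  fixes K :: "'a::euclidean_space set"
  assumes "convex K" "K \<noteq> {}"
    and P: "\<And>u. norm u = 1 \<Longrightarrow> \<exists>p\<in>P. s + u \<bullet> w \<le> u \<bullet> p"
    and near: "\<And>p. p \<in> P \<Longrightarrow> \<exists>z\<in>K. dist p z \<le> e"
  shows "ball w (s - e) \<subseteq> interior K"
proof -
  have "y \<in> closure K" if y: "y \<in> ball w (s - e)" for y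
  proof (rule ccontr)
    assume "y \<notin> closure K"
    then obtain a b where ab: "a \<bullet> y < b" "\<And>z. z \<in> closure K \<Longrightarrow> b < a \<bullet> z"
      using separating_hyperplane_closed_point[of "closure K" y] assms(1) by (auto simp: convex_closure)
    have "a \<noteq> 0"
      using ab assms(2) closure_subset[of K] by force
    define u where "u = - (1 / norm a) *\<^sub>R a"
    have u: "norm u = 1"
      using \<open>a \<noteq> 0\<close> by (simp add: u_def)
    obtain p z where p: "p \<in> P" "s + u \<bullet> w \<le> u \<bullet> p" and z: "z \<in> K" "dist p z \<le> e"
      using P[OF u] near by blast
    have "a \<bullet> y < a \<bullet> z"
      using ab z(1) closure_subset[of K] by force
    then have "u \<bullet> z < u \<bullet> y"
      using \<open>a \<noteq> 0\<close> by (simp add: u_def divide_simps)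
    moreover have "u \<bullet> p - u \<bullet> z \<le> e" "u \<bullet> y - u \<bullet> w \<le> dist w y"
      using norm_cauchy_schwarz[of u "p - z"] norm_cauchy_schwarz[of u "y - w"] u z(2)
      by (simp_all add: inner_diff_right dist_norm norm_minus_commute)
    ultimately show False
      using p(2) y by simp
  qed
  then have "ball w (s - e) \<subseteq> interior (closure K)"
    by (intro interior_maximal) auto
  then show ?thesis
    using assms(1) by (simp add: convex_interior_closure)
qed

text \<open>The extremal point at distance \<rho> is not in the open ball, so the bound is proved
  for every r < \<rho> and passed to the limit.\<close>

lemma radius_le_support:
  fixes K :: "'a::euclidean_space set"
  assumes "ball w \<rho> \<subseteq> K" "0 < \<rho>" "norm u = 1" "\<And>z. z \<in> K \<Longrightarrow> u \<bullet> z \<le> s + u \<bullet> w"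
  shows "\<rho> \<le> s"
proof (rule dense_le_bounded[OF assms(2)])
  fix r assume r: "0 < r" "r < \<rho>"
  then have "w + r *\<^sub>R u \<in> K"
    using assms(1,3) by (intro subsetD[OF assms(1)]) (simp add: dist_norm)
  then have "u \<bullet> (w + r *\<^sub>R u) \<le> s + u \<bullet> w"
    by (rule assms(4))
  then show "r \<le> s"
    using assms(3) by (simp add: inner_add_right power2_norm_eq_inner[symmetric])
qed

section \<open>Replacing all unit directions by an integer grid\<close>

lemma norm_le_card:
  fixes x :: "real ^ 'm"
  assumes "\<And>i. \<bar>x $ i\<bar> \<le> 1"
  shows "norm x \<le> real CARD('m)"
proof -
  have "norm x \<le> (\<Sum>i\<in>UNIV. \<bar>x $ i\<bar>)"
    by (rule norm_le_l1_cart)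
  also have "\<dots> \<le> (\<Sum>i\<in>(UNIV :: 'm set). 1)"
    by (intro sum_mono assms)
  finally show ?thesis by simp
qed

text \<open>Says that t is at most the minimum over grid directions of the support function of Y,
  with the normalisation of g cleared. The direction 0 only demands that Y is nonempty.\<close>

definition grid_test :: "nat \<Rightarrow> (real ^ 'm) set \<Rightarrow> nat \<Rightarrow> bool" where
  "grid_test N Y t \<longleftrightarrow>
     (\<forall>g :: 'm \<Rightarrow> int. (\<forall>i. \<bar>g i\<bar> \<le> int N) \<longrightarrow>
        (\<exists>y\<in>Y. real t * norm (\<chi> i. real_of_int (g i)) \<le> (\<chi> i. real_of_int (g i)) \<bullet> y))"

text \<open>Rounding N u down gives a grid vector g within m = \<open>CARD('m)\<close> of N u,
  nonzero because m < N. Passing from g to N u costs at most m B in the inner product and m t \<le>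
  m B in the norm, together at most N; after division by N the loss is at most 1.\<close>

lemma grid_test_lower:
  fixes Y :: "(real ^ 'm) set"
  assumes test: "grid_test N Y t" and Y: "\<And>y. y \<in> Y \<Longrightarrow> norm y \<le> real B"
    and N: "2 * CARD('m) * B \<le> N" "CARD('m) < N" and u: "norm u = 1"
  shows "\<exists>y\<in>Y. real t - 1 \<le> u \<bullet> y" "t \<le> B"
proof -
  let ?m = "real CARD('m)"
  define g :: "real ^ 'm" where "g = (\<chi> i. real_of_int \<lfloor>real N * u $ i\<rfloor>)"
  have "\<bar>\<lfloor>real N * u $ i\<rfloor>\<bar> \<le> int N" for i
  proof -
    have "\<bar>u $ i\<bar> \<le> 1"
      using component_le_norm_cart[of u i] u by simp
    then have "- real N \<le> real N * u $ i" "real N * u $ i \<le> real N"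
      using mult_left_mono[of "u $ i" 1 "real N"] mult_left_mono[of "-1" "u $ i" "real N"] by auto
    then show ?thesis
      by linarith
  qed
  then obtain y where y: "y \<in> Y" "real t * norm g \<le> g \<bullet> y"
    using test[unfolded grid_test_def, THEN spec[of _ "\<lambda>i. \<lfloor>real N * u $ i\<rfloor>"]] unfolding g_def by blast
  have diff: "norm (g - real N *\<^sub>R u) \<le> ?m"
    by (rule norm_le_card) (simp add: g_def, linarith)
  have "norm (real N *\<^sub>R u) \<le> norm g + norm (g - real N *\<^sub>R u)"
    by (metis norm_triangle_sub norm_minus_commute)
  then have g: "real N - ?m \<le> norm g"
    using diff u by simp
  have pos: "0 < norm g"
    using g N(2) by linarith
  have yB: "norm y \<le> real B"
    by (rule Y[OF y(1)])
  have "real t * norm g \<le> norm g * norm y"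
    using y(2) norm_cauchy_schwarz[of g y] by linarith
  then have "real t \<le> norm y"
    using pos by (simp add: mult.commute)
  then have tB: "real t \<le> real B"
    using yB by linarith
  then show "t \<le> B" by simp
  have "g \<bullet> y - real N * (u \<bullet> y) = (g - real N *\<^sub>R u) \<bullet> y"
    by (simp add: inner_diff_left)
  also have "\<dots> \<le> norm (g - real N *\<^sub>R u) * norm y"
    by (rule norm_cauchy_schwarz)
  also have "\<dots> \<le> ?m * real B"
    using diff yB by (intro mult_mono) auto
  finally have "g \<bullet> y - ?m * real B \<le> real N * (u \<bullet> y)"
    by simp
  moreover have "real t * (real N - ?m) \<le> real t * norm g"
    using g by (intro mult_left_mono) auto
  then have "real N * real t - ?m * real t \<le> real t * norm g"
    by (simp add: algebra_simps)
  moreover have "?m * real t \<le> ?m * real B"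
    using tB by (intro mult_left_mono) auto
  moreover have "2 * ?m * real B \<le> real N"
    using N(1) by (metis of_nat_le_iff of_nat_mult of_nat_numeral)
  ultimately have "real N * real t - real N \<le> real N * (u \<bullet> y)"
    using y(2) by linarith
  then have "real N * (real t - 1) \<le> real N * (u \<bullet> y)"
    by (simp add: right_diff_distrib)
  then have "real t - 1 \<le> u \<bullet> y"
    using N(2) by simp
  with y(1) show "\<exists>y\<in>Y. real t - 1 \<le> u \<bullet> y"
    by blast
qed

text \<open>\<open>X p\<close> and \<open>V\<close> stand for the rounded multiples of p and v by D,
  and \<open>e\<close> bounds both input errors. Separation uses a vertex near K, whereas points of
  K are only near the hull of the vertices; this explains the asymmetry between
  \<open>P_near\<close> and \<open>K_near\<close>.\<close>

locale approximated_convex_body =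
  fixes K P :: "(real ^ 'm) set" and w v V :: "real ^ 'm" and X :: "real ^ 'm \<Rightarrow> real ^ 'm"
    and e D :: real and B N :: nat
  assumes K: "convex K" "bounded K" "w \<in> interior K"
    and P: "P \<noteq> {}"
    and P_near: "\<And>p. p \<in> P \<Longrightarrow> \<exists>z\<in>K. dist p z \<le> e"
    and K_near: "\<And>z. z \<in> K \<Longrightarrow> \<exists>y\<in>convex hull P. dist z y \<le> e"
    and v: "norm (w - v) \<le> e"
    and D: "0 < D"
    and X: "\<And>p. p \<in> P \<Longrightarrow> norm (X p - D *\<^sub>R p) \<le> CARD('m)"
    and V: "norm (V - D *\<^sub>R v) \<le> CARD('m)"
    and B: "\<And>p. p \<in> P \<Longrightarrow> norm (X p - V) \<le> real B"
    and N: "2 * CARD('m) * B \<le> N" "CARD('m) < N"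
begin

abbreviation radius :: real where "radius \<equiv> largest_radius (interior K) w"

abbreviation test :: "nat \<Rightarrow> bool" where "test \<equiv> grid_test N ((\<lambda>p. X p - V) ` P)"

lemma radius_maximal: "0 < radius" "ball w radius \<subseteq> interior K" "\<And>\<rho>. 0 < \<rho> \<Longrightarrow> ball w \<rho> \<subseteq> interior K \<Longrightarrow> \<rho> \<le> radius"
  using largest_radius[of "interior K" w] K(2,3) bounded_subset[OF _ interior_subset] by auto

lemma rounding:
  assumes "norm u = 1" "p \<in> P"
  shows "\<bar>u \<bullet> (X p - V) - D * (u \<bullet> p - u \<bullet> v)\<bar> \<le> 2 * CARD('m)"
proof -
  have "u \<bullet> (X p - V) - D * (u \<bullet> p - u \<bullet> v) = u \<bullet> ((X p - D *\<^sub>R p) - (V - D *\<^sub>R v))"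
    by (simp add: inner_diff_right algebra_simps)
  also have "\<bar>\<dots>\<bar> \<le> norm u * norm ((X p - D *\<^sub>R p) - (V - D *\<^sub>R v))"
    by (rule Cauchy_Schwarz_ineq2)
  also have "\<dots> \<le> norm (X p - D *\<^sub>R p) + norm (V - D *\<^sub>R v)"
    using assms(1) norm_triangle_ineq4 by simp
  also have "\<dots> \<le> 2 * CARD('m)"
    using X[OF assms(2)] V by simp
  finally show ?thesis .
qed

lemma shift: "norm u = 1 \<Longrightarrow> \<bar>u \<bullet> w - u \<bullet> v\<bar> \<le> e"
  using Cauchy_Schwarz_ineq2[of u "w - v"] v by (simp add: inner_diff_right)

lemma radius_ge:
  assumes "test t"
  shows "(real t - 1 - 2 * CARD('m)) / D - 2 * e \<le> radius"
proof -
  \<comment> \<open>The 1 is lost to the grid, 2 m to rounding p and v, and e to replacing w by v;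
    another e is lost below between the vertices and K.\<close>
  let ?s = "(real t - 1 - 2 * CARD('m)) / D - e"
  have "ball w (?s - e) \<subseteq> interior K"
  proof (rule ball_subset_interior_convex)
    fix u :: "real ^ 'm" assume u: "norm u = 1"
    obtain p where p: "p \<in> P" "real t - 1 \<le> u \<bullet> (X p - V)"
      using grid_test_lower(1)[OF assms _ N u] B by blast
    have "real t - 1 - 2 * CARD('m) \<le> D * (u \<bullet> p - u \<bullet> v)"
      using p(2) rounding[OF u p(1)] by linarith
    then have "(real t - 1 - 2 * CARD('m)) / D \<le> u \<bullet> p - u \<bullet> v"
      using D by (simp add: divide_le_eq mult.commute)
    then have "?s + u \<bullet> w \<le> u \<bullet> p"
      using shift[OF u] by linarith
    then show "\<exists>p\<in>P. ?s + u \<bullet> w \<le> u \<bullet> p"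
      using p(1) by blast
  qed (use K P_near interior_subset in auto)
  then have "?s - e \<le> radius"
    using radius_maximal(1) radius_maximal(3)[of "?s - e"] by (cases "0 < ?s - e") auto
  then show ?thesis
    by simp
qed

text \<open>A single failing direction bounds all vertices, hence the polytope, hence K up to e. The
  fineness of the grid does not enter this estimate.\<close>

lemma radius_le:
  assumes "\<not> test t"
  shows "radius \<le> (real t + 2 * CARD('m)) / D + 2 * e"
proof -
  obtain h :: "'m \<Rightarrow> int" where
    "\<And>y. y \<in> (\<lambda>p. X p - V) ` P \<Longrightarrow> \<not> real t * norm (\<chi> i. real_of_int (h i)) \<le> (\<chi> i. real_of_int (h i)) \<bullet> y"
    using assms unfolding grid_test_def by blast
  moreover define g :: "real ^ 'm" where "g = (\<chi> i. real_of_int (h i))"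
  ultimately have g: "g \<bullet> (X p - V) < real t * norm g" if "p \<in> P" for p
    using that by fastforce
  \<comment> \<open>The zero direction cannot fail, because P is nonempty.\<close>
  have "g \<noteq> 0"
    using g P by force
  define u where "u = (1 / norm g) *\<^sub>R g"
  have u: "norm u = 1"
    using \<open>g \<noteq> 0\<close> by (simp add: u_def)
  have hull: "u \<bullet> y \<le> (real t + 2 * CARD('m)) / D + u \<bullet> v" if "y \<in> convex hull P" for y
  proof -
    have "u \<bullet> p \<le> (real t + 2 * CARD('m)) / D + u \<bullet> v" if p: "p \<in> P" for p
    proof -
      have "u \<bullet> (X p - V) \<le> real t"
        using g[OF p] \<open>g \<noteq> 0\<close> by (simp add: u_def divide_simps)
      then have "D * (u \<bullet> p - u \<bullet> v) \<le> real t + 2 * CARD('m)"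
        using rounding[OF u p] by linarith
      then have "u \<bullet> p - u \<bullet> v \<le> (real t + 2 * CARD('m)) / D"
        using D by (simp add: le_divide_eq mult.commute)
      then show ?thesis by simp
    qed
    then have "convex hull P \<subseteq> {y. u \<bullet> y \<le> (real t + 2 * CARD('m)) / D + u \<bullet> v}"
      by (intro hull_minimal convex_halfspace_le) auto
    then show ?thesis
      using that by blast
  qed
  show ?thesis
  proof (rule radius_le_support[OF _ radius_maximal(1) u])
    show "ball w radius \<subseteq> K"
      using radius_maximal(2) interior_subset by blast
    fix z assume "z \<in> K"
    then obtain y where y: "y \<in> convex hull P" "dist z y \<le> e"
      using K_near by blast
    have "u \<bullet> z - u \<bullet> y \<le> e"
      using norm_cauchy_schwarz[of u "z - y"] u y(2) by (simp add: inner_diff_right dist_norm)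
    then show "u \<bullet> z \<le> (real t + 2 * CARD('m)) / D + 2 * e + u \<bullet> w"
      using hull[OF y(1)] shift[OF u] by linarith
  qed
qed

lemma radius_approx:
  assumes "\<forall>i<t. test i" "t = N + 2 \<or> \<not> test t"
  shows "\<bar>radius - real t / D\<bar> \<le> (2 + 2 * CARD('m)) / D + 2 * e"
proof -
  obtain u :: "real ^ 'm" where u: "norm u = 1"
    using vector_choose_size[of 1] by auto
  have bound: "i \<le> B" if "test i" for i
    using grid_test_lower(2)[OF that _ N u] B by blast
  have "B \<le> N"
    using N(1) by (rule order.trans[rotated]) simp
  have "\<not> test (Suc N)"
    using bound[of "Suc N"] \<open>B \<le> N\<close> by auto
  \<comment> \<open>If t were N + 2, the test would have succeeded at \<open>Suc N\<close>.\<close>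
  then have "\<not> test t"
    using assms by auto
  then have "radius \<le> (real t + 2 * CARD('m)) / D + 2 * e"
    by (rule radius_le)
  moreover have "real t / D - ((2 + 2 * CARD('m)) / D + 2 * e) \<le> radius"
  \<comment> \<open>For t = 0 no successful test is at hand and positivity of the radius suffices.
    Otherwise the last success was at t - 1, which adds a second 1 to the error.\<close>
  proof (cases t)
    case 0
    have "0 \<le> e"
      using v norm_ge_zero order.trans by blast
    then have "0 \<le> (2 + 2 * CARD('m)) / D + 2 * e"
      using D by simp
    then show ?thesis
      using 0 radius_maximal(1) by simp
  next
    case (Suc i)
    then show ?thesis
      using radius_ge[of i] assms(1) by (simp add: diff_divide_distrib add_divide_distrib)
  qed
  moreover have "(real t + 2 * CARD('m)) / D \<le> real t / D + (2 + 2 * CARD('m)) / D"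
    using D by (simp add: add_divide_distrib)
  ultimately show ?thesis
    by linarith
qed

end

text \<open>The infimum over the other set need not be attained, so only a strictly larger bound
  yields an actual point; 2 e is convenient.\<close>

lemma hausdorff_dist_le:
  assumes "hausdorff_dist A K \<le> ennreal e" "0 < e"
  shows "a \<in> A \<Longrightarrow> \<exists>z\<in>K. dist a z \<le> 2 * e" and "z \<in> K \<Longrightarrow> \<exists>a\<in>A. dist z a \<le> 2 * e"
proof -
  have e: "ennreal e < ennreal (2 * e)"
    using assms(2) by (simp add: ennreal_lessI)
  show "\<exists>z\<in>K. dist a z \<le> 2 * e" if "a \<in> A"
  proof -
    have "(INF b\<in>K. ennreal (dist a b)) \<le> hausdorff_dist A K"
      unfolding hausdorff_dist_def using that by (intro max.coboundedI1 SUP_upper)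
    then have "(INF b\<in>K. ennreal (dist a b)) < ennreal (2 * e)"
      using assms(1) e by (meson le_less_trans order.trans)
    then obtain z where "z \<in> K" "ennreal (dist a z) < ennreal (2 * e)"
      unfolding INF_less_iff by blast
    then show ?thesis
      using ennreal_less_iff[of "dist a z" "2 * e"] by (auto intro: less_imp_le)
  qed
  show "\<exists>a\<in>A. dist z a \<le> 2 * e" if "z \<in> K"
  proof -
    have "(INF a\<in>A. ennreal (dist a z)) \<le> hausdorff_dist A K"
      unfolding hausdorff_dist_def using that by (intro max.coboundedI2 SUP_upper2[of z]) auto
    then have "(INF a\<in>A. ennreal (dist a z)) < ennreal (2 * e)"
      using assms(1) e by (meson le_less_trans order.trans)
    then obtain a where "a \<in> A" "ennreal (dist a z) < ennreal (2 * e)"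
      unfolding INF_less_iff by blast
    then show ?thesis
      using ennreal_less_iff[of "dist a z" "2 * e"] by (auto simp: dist_commute intro: less_imp_le)
  qed
qed

section \<open>The algorithm\<close>

text \<open>Up to the shift by \<open>Z\<close>, which cancels, the inner product of \<open>u - (N, \<dots>, N)\<close> with the difference of the
  scaled vectors coded by \<open>p\<close> and \<open>q\<close> is \<open>mixed_dot m N D Z u p q - mixed_dot m N D Z u q p\<close>.\<close>

definition mixed_dot :: "nat \<Rightarrow> nat \<Rightarrow> nat \<Rightarrow> nat \<Rightarrow> nat \<Rightarrow> nat \<Rightarrow> nat \<Rightarrow> nat" where
  "mixed_dot m N D Z u p q = (\<Sum>j<m. nnth u j * scaled D Z (nnth p j) + N * scaled D Z (nnth q j))"

text \<open>The squared norm of the grid vector. One of the two truncated differences vanishes, so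
  their sum is the absolute value of the coordinate.\<close>

definition grid_square :: "nat \<Rightarrow> nat \<Rightarrow> nat \<Rightarrow> nat" where
  "grid_square m N u = (\<Sum>j<m. ((nnth u j - N) + (N - nnth u j)) * ((nnth u j - N) + (N - nnth u j)))"

text \<open>The inequality of \<open>grid_test\<close> in one direction, squared. The condition on
  \<open>ndrop\<close> says that i is a position of the list coded by P; the comparison of the two
  mixed sums is the sign check that makes squaring legitimate.\<close>

definition direction_test ::
  "nat \<Rightarrow> nat \<Rightarrow> nat \<Rightarrow> nat \<Rightarrow> nat \<Rightarrow> nat \<Rightarrow> nat \<Rightarrow> nat \<Rightarrow> bool" where
  "direction_test m N D Z P V t u \<longleftrightarrow> (\<exists>i<P. 0 < ndrop P i \<and>
     mixed_dot m N D Z u V (nnth P i) \<le> mixed_dot m N D Z u (nnth P i) V \<and>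
     t * t * grid_square m N u \<le>
       (mixed_dot m N D Z u (nnth P i) V - mixed_dot m N D Z u V (nnth P i))
         * (mixed_dot m N D Z u (nnth P i) V - mixed_dot m N D Z u V (nnth P i)))"

text \<open>Entries 0 to 2 N represent the coordinates -N to N, and the final 0 is the code of the
  empty list.\<close>

definition search :: "nat \<Rightarrow> nat \<Rightarrow> nat \<Rightarrow> nat \<Rightarrow> nat \<Rightarrow> nat \<Rightarrow> nat" where
  "search m N D Z P V =
     ((\<lambda>t. if all_lists m (2 * N + 1) (direction_test m N D Z P V t) 0 then Suc t else t) ^^ (N + 2)) 0"

text \<open>The answer \<open>t / D\<close> is replaced by \<open>(t D + 1) / D\<^sup>2\<close>, which is already in lowest terms.\<close>

definition radius_code :: "nat \<Rightarrow> nat \<Rightarrow> nat \<Rightarrow> nat \<Rightarrow> nat \<Rightarrow> nat" where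
  "radius_code m c C B z =
     prod_encode
       (2 * (search m (2 ^ (pfst z + c) * C) (2 ^ (pfst z + c)) (2 ^ (pfst z + c) * (B + 2))
               (pfst (psnd z)) (psnd (psnd z)) * 2 ^ (pfst z + c) + 1),
        2 ^ (pfst z + c) * 2 ^ (pfst z + c))"

lemma precp_direction_test:
  assumes "prec N" "prec D" "prec Z" "prec P" "prec V" "prec t" "prec u"
  shows "precp (\<lambda>x. direction_test m (N x) (D x) (Z x) (P x) (V x) (t x) (u x))"
  unfolding direction_test_def mixed_dot_def grid_square_def
  by (intro precp_ex precp_conj precp_less precp_le prec_ndrop prec_sum prec_add prec_mult prec_diff
      prec_scaled prec_nnth prec_const prec_pfst' prec_psnd' prec_id assms[THEN prec_comp])

lemma prec_search:
  assumes "prec N" "prec D" "prec Z" "prec P" "prec V"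
  shows "prec (\<lambda>x. search m (N x) (D x) (Z x) (P x) (V x))"
  unfolding search_def
  by (intro prec_funpow' prec_if precp_all_lists precp_direction_test prec_add prec_mult prec_const
      prec_Suc' prec_pfst' prec_psnd' prec_id assms[THEN prec_comp])

lemma prec_radius_code: "prec (radius_code m c C B)"
  unfolding radius_code_def
  by (intro prec_pair prec_add prec_mult prec_search prec_power2 prec_const prec_pfst' prec_psnd' prec_id)

text \<open>Removes the square root s of S. Without b \<le> a the truncated difference would be
  meaningless, while the right-hand inequality fails because its left side is nonnegative.\<close>

lemma square_test:
  assumes "0 \<le> s" "s * s = real S"
  shows "b \<le> a \<and> t * t * S \<le> (a - b) * (a - b) \<longleftrightarrow> real t * s \<le> real a - real b"
proof (cases "b \<le> a")
  case True
  then have "t * t * S \<le> (a - b) * (a - b) \<longleftrightarrow> real (t * t * S) \<le> real ((a - b) * (a - b))"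
    by (simp only: of_nat_le_iff)
  also have "real (t * t * S) = (real t * s)\<^sup>2"
    by (simp add: power2_eq_square assms(2)[symmetric])
  also have "real ((a - b) * (a - b)) = (real a - real b)\<^sup>2"
    by (simp only: of_nat_mult of_nat_diff[OF True] power2_eq_square)
  also have "(real t * s)\<^sup>2 \<le> (real a - real b)\<^sup>2 \<longleftrightarrow> real t * s \<le> real a - real b"
    using True assms(1) by (intro power_mono_iff) auto
  finally show ?thesis
    using True by simp
next
  case False
  moreover have "0 \<le> real t * s"
    using assms(1) by simp
  ultimately show ?thesis by auto
qed

section \<open>Agreement of the coded test with the geometric one\<close>

abbreviation index :: "nat \<Rightarrow> 'm::finite" where
  "index \<equiv> from_nat_into UNIV"

lemma bij_index: "bij_betw (index :: nat \<Rightarrow> 'm::finite) {..<CARD('m)} UNIV"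
  by (rule bij_betw_from_nat_into_finite) simp

lemma sum_index: "(\<Sum>j<CARD('m). F (index j :: 'm::finite)) = (\<Sum>i\<in>UNIV. F i)"
  by (rule sum.reindex_bij_betw[OF bij_index])

lemma nnth_rat_vec_code:
  fixes v :: "rat ^ 'm"
  shows "j < CARD('m) \<Longrightarrow> nnth (rat_vec_code v) j = rat_code (v $ index j)"
  by (simp add: rat_vec_code_def nnth_list_encode)

lemma nnth_points_code: "i < length ps \<Longrightarrow> nnth (points_code ps) i = rat_vec_code (ps ! i)"
  by (simp add: points_code_def nnth_list_encode)

definition rounded :: "nat \<Rightarrow> nat \<Rightarrow> rat ^ 'm \<Rightarrow> real ^ 'm" where
  "rounded D Z v = (\<chi> i. real (scaled D Z (rat_code (v $ i))) - real Z)"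

lemma norm_rounded:
  fixes v :: "rat ^ 'm"
  assumes "real D * norm (real_vec v) \<le> real Z"
  shows "norm (rounded D Z v - real D *\<^sub>R real_vec v) \<le> real CARD('m)"
proof (rule norm_le_card)
  fix i
  have "\<bar>real_of_rat (v $ i)\<bar> \<le> norm (real_vec v)"
    using component_le_norm_cart[of "real_vec v" i] by (simp add: real_vec_def)
  then have "\<bar>real D * real_of_rat (v $ i)\<bar> \<le> real D * norm (real_vec v)"
    by (simp add: abs_mult mult_left_mono)
  then have "\<bar>real D * real_of_rat (v $ i)\<bar> \<le> real Z"
    using assms by linarith
  from scaled_rat_code[OF this] show "\<bar>(rounded D Z v - real D *\<^sub>R real_vec v) $ i\<bar> \<le> 1"
    by (simp add: rounded_def real_vec_def)
qed

lemma direction_test_iff: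
  fixes ps :: "(rat ^ 'm) list" and g :: "real ^ 'm"
  assumes u: "length u = CARD('m)" and g: "\<And>j. j < CARD('m) \<Longrightarrow> g $ index j = real (u ! j) - real N"
  shows "direction_test CARD('m) N D Z (points_code ps) (rat_vec_code v) t (list_encode u) \<longleftrightarrow>
    (\<exists>p\<in>set ps. real t * norm g \<le> g \<bullet> (rounded D Z p - rounded D Z v))"
proof -
  let ?m = "CARD('m)" and ?U = "list_encode u" and ?V = "rat_vec_code v" and ?P = "points_code ps"
  let ?S = "grid_square ?m N ?U"
  let ?A = "\<lambda>i. mixed_dot ?m N D Z ?U (nnth ?P i) ?V"
  let ?B = "\<lambda>i. mixed_dot ?m N D Z ?U ?V (nnth ?P i)"
  have abs_diff: "real ((a - b) + (b - a)) * real ((a - b) + (b - a)) = (real a - real b) * (real a - real b)"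
    for a b :: nat
    by (cases "a \<le> b") (auto simp: of_nat_diff algebra_simps)
  have "norm g * norm g = (\<Sum>i\<in>UNIV. g $ i * g $ i)"
    using power2_norm_eq_inner[of g] by (simp add: power2_eq_square inner_vec_def)
  also have "\<dots> = (\<Sum>j<?m. g $ index j * g $ index j)"
    by (rule sum_index[symmetric])
  also have "\<dots> = (\<Sum>j<?m. real (((nnth ?U j - N) + (N - nnth ?U j)) * ((nnth ?U j - N) + (N - nnth ?U j))))"
    by (intro sum.cong refl) (use g u in \<open>simp add: abs_diff nnth_list_encode del: of_nat_add\<close>)
  finally have S: "norm g * norm g = real ?S"
    by (simp add: grid_square_def)
  have dot: "real (?A i) - real (?B i) = g \<bullet> (rounded D Z (ps ! i) - rounded D Z v)" if i: "i < length ps" for i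
  proof -
    have "g \<bullet> (rounded D Z (ps ! i) - rounded D Z v) =
        (\<Sum>j<?m. g $ index j * (rounded D Z (ps ! i) - rounded D Z v) $ index j)"
      using sum_index[of "\<lambda>k. g $ k * (rounded D Z (ps ! i) - rounded D Z v) $ k"] by (simp add: inner_vec_def)
    \<comment> \<open>The product of u - N with a difference is multiplied out and sorted by sign;
      the offset Z has dropped out of that difference.\<close>
    also have "\<dots> = (\<Sum>j<?m.
        real (nnth ?U j * scaled D Z (nnth (nnth ?P i) j) + N * scaled D Z (nnth ?V j))
      - real (nnth ?U j * scaled D Z (nnth ?V j) + N * scaled D Z (nnth (nnth ?P i) j)))"
      by (intro sum.cong refl)
        (simp add: nnth_list_encode nnth_points_code nnth_rat_vec_code rounded_def g u i,
          simp add: algebra_simps)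
    finally show ?thesis
      by (simp add: mixed_dot_def sum_subtractf)
  qed
  have test: "?B i \<le> ?A i \<and> t * t * ?S \<le> (?A i - ?B i) * (?A i - ?B i) \<longleftrightarrow>
      real t * norm g \<le> g \<bullet> (rounded D Z (ps ! i) - rounded D Z v)" if "i < length ps" for i
    unfolding dot[OF that, symmetric] by (rule square_test[OF norm_ge_zero S])
  have "i < ?P \<and> 0 < ndrop ?P i \<longleftrightarrow> i < length ps" for i
    using length_le_list_encode[of "map rat_vec_code ps"] ndrop_nonzero_iff[of "map rat_vec_code ps" i]
    by (auto simp: points_code_def)
  then have "direction_test ?m N D Z ?P ?V t ?U \<longleftrightarrow>
      (\<exists>i<length ps. ?B i \<le> ?A i \<and> t * t * ?S \<le> (?A i - ?B i) * (?A i - ?B i))"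
    unfolding direction_test_def by blast
  also have "\<dots> \<longleftrightarrow> (\<exists>i<length ps. real t * norm g \<le> g \<bullet> (rounded D Z (ps ! i) - rounded D Z v))"
    using test by blast
  also have "\<dots> \<longleftrightarrow> (\<exists>p\<in>set ps. real t * norm g \<le> g \<bullet> (rounded D Z p - rounded D Z v))"
    by (metis in_set_conv_nth)
  finally show ?thesis .
qed

text \<open>Shifting by N identifies the lists enumerated by the search with the integer vectors of
  the grid.\<close>

lemma all_lists_direction_test:
  fixes ps :: "(rat ^ 'm) list"
  shows "all_lists CARD('m) (2 * N + 1) (direction_test CARD('m) N D Z (points_code ps) (rat_vec_code v) t) 0 \<longleftrightarrow>
    grid_test N ((\<lambda>p. rounded D Z p - rounded D Z v) ` set ps) t"
    (is "all_lists ?m _ ?T 0 \<longleftrightarrow> ?G")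
proof -
  let ?vec = "\<lambda>g :: 'm \<Rightarrow> int. \<chi> i. real_of_int (g i)"
  have "all_lists ?m (2 * N + 1) ?T 0 \<longleftrightarrow>
      (\<forall>u. length u = ?m \<longrightarrow> set u \<subseteq> {..<2 * N + 1} \<longrightarrow> ?T (list_encode u))"
    using all_lists_iff[of ?m "2 * N + 1" ?T "[]"] by simp
  also have "\<dots> \<longleftrightarrow> (\<forall>g :: 'm \<Rightarrow> int. (\<forall>i. \<bar>g i\<bar> \<le> int N) \<longrightarrow>
      (\<exists>p\<in>set ps. real t * norm (?vec g) \<le> ?vec g \<bullet> (rounded D Z p - rounded D Z v)))"
  proof (intro iffI allI impI)
    fix g :: "'m \<Rightarrow> int"
    assume *: "\<forall>u. length u = ?m \<longrightarrow> set u \<subseteq> {..<2 * N + 1} \<longrightarrow> ?T (list_encode u)"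
      and g: "\<forall>i. \<bar>g i\<bar> \<le> int N"
    define u where "u = map (\<lambda>j. nat (g (index j) + int N)) [0..<?m]"
    have "nat (g i + int N) < 2 * N + 1" for i
      using g[rule_format, of i] by linarith
    then have u: "length u = ?m" "set u \<subseteq> {..<2 * N + 1}"
      by (auto simp: u_def)
    have lower: "0 \<le> g i + int N" for i
      using g[rule_format, of i] by linarith
    then have "(?vec g) $ index j = real (u ! j) - real N" if "j < ?m" for j
      using that lower[of "index j"] by (simp add: u_def of_nat_nat)
    from direction_test_iff[OF u(1) this] * u
    show "\<exists>p\<in>set ps. real t * norm (?vec g) \<le> ?vec g \<bullet> (rounded D Z p - rounded D Z v)"
      by blast
  next
    fix u :: "nat list"
    assume *: "\<forall>g :: 'm \<Rightarrow> int. (\<forall>i. \<bar>g i\<bar> \<le> int N) \<longrightarrow>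
        (\<exists>p\<in>set ps. real t * norm (?vec g) \<le> ?vec g \<bullet> (rounded D Z p - rounded D Z v))"
      and u: "length u = ?m" "set u \<subseteq> {..<2 * N + 1}"
    define g :: "'m \<Rightarrow> int" where "g i = int (u ! the_inv_into {..<?m} index i) - int N" for i
    have g: "g (index j) = int (u ! j) - int N" if "j < ?m" for j
      using that bij_index[where 'm = 'm] by (simp add: g_def the_inv_into_f_f bij_betw_def)
    have "\<bar>g i\<bar> \<le> int N" for i
    proof -
      obtain j where j: "j < ?m" "i = index j"
        using bij_betw_imp_surj_on[OF bij_index[where 'm = 'm]] by (metis UNIV_I imageE lessThan_iff)
      then have "u ! j < 2 * N + 1"
        using u by (metis lessThan_iff nth_mem subsetD)
      then show ?thesis
        using g[OF j(1)] j(2) by auto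
    qed
    moreover have "(?vec g) $ index j = real (u ! j) - real N" if "j < ?m" for j
      using g[OF that] by simp
    ultimately show "?T (list_encode u)"
      using direction_test_iff[OF u(1), of "?vec g"] * by blast
  qed
  finally show ?thesis
    by (simp add: grid_test_def)
qed

text \<open>\<open>rat_code\<close> sees the reduced fraction, so the output must be in lowest terms
  without a gcd computation: a common divisor of t D + 1 and D divides 1.\<close>

lemma rat_code_coprime:
  assumes "0 < D"
  shows "prod_encode (2 * (t * D + 1), D * D) = rat_code (Fract (int (t * D + 1)) (int (D * D)))"
proof -
  have "coprime (t * D + 1) D"
    by (rule coprimeI) (metis dvd_add_right_iff dvd_mult)
  then have "coprime (int (t * D + 1)) (int D)"
    by (simp only: coprime_int_iff)
  then have "quotient_of (Fract (int (t * D + 1)) (int (D * D))) = (int (t * D + 1), int (D * D))"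
    using assms by (simp add: quotient_of_Fract normalize_stable del: of_nat_add)
  then show ?thesis
    by (simp add: rat_code_def int_encode_def sum_encode_def del: of_nat_mult of_nat_add)
qed

lemma real_vec_inv [simp]: "inv real_vec (real_vec v) = v"
proof (rule inv_f_f, rule injI)
  fix x y :: "rat ^ 'm"
  assume "real_vec x = real_vec y"
  then show "x = y"
    by (simp add: real_vec_def vec_eq_iff)
qed

text \<open>The error in units of 1 / D is 2 + 2 m from grid and rounding, 4 from 2 e with e = 2 /
  D, and 1 from the reduced fraction. The sum is c = 2 m + 7, and c < \<open>2 ^ c\<close> brings
  the total below \<open>1 / 2 ^ n\<close>.\<close>

lemma radius_code_correct:
  fixes K :: "(real ^ 'm) set" and ps :: "(rat ^ 'm) list" and n B :: nat
  defines "m \<equiv> CARD('m)"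
  defines "c \<equiv> 2 * m + 7"
  assumes K: "convex K" "w \<in> interior K" and bound: "\<And>z. z \<in> K \<Longrightarrow> norm z \<le> real B"
    and ps: "hausdorff_dist (convex hull (real_vec ` set ps)) K \<le> ennreal (1 / 2 ^ (n + c))"
    and v: "norm (w - real_vec v) < 1 / 2 ^ (n + c)"
  shows "approx_real (largest_radius (interior K) w) n
    (radius_code m c (2 * m * (2 * B + 4 + 2 * m)) B
      (prod_encode (n, prod_encode (points_code ps, rat_vec_code v))))"
proof -
  define D :: nat where "D = 2 ^ (n + c)"
  \<comment> \<open>Vertices and v lie within e \<le> 2 of K, so their norms are at most B + 2; this
    gives Z. Scaled differences are then at most D (2 B + 4) + 2 m \<le> D (2 B + 4 + 2 m), and N is
    2 m times that bound.\<close>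
  define N where "N = D * (2 * m * (2 * B + 4 + 2 * m))"
  define Z where "Z = D * (B + 2)"
  define e where "e = 2 / real D"
  \<comment> \<open>The locale rounds points of the real space, whereas \<open>rounded\<close> takes
    rational vectors; the inverse recovers them on the vertices.\<close>
  define X where "X p = rounded D Z (inv real_vec p :: rat ^ 'm)" for p
  have m: "0 < m"
    unfolding m_def by simp
  have D_pos: "1 \<le> real D" "0 < D" "1 / 2 ^ (n + c) = 1 / real D"
    by (simp_all add: D_def)
  have e: "0 < e" "e \<le> 2" "real D * e = 2"
    using D_pos by (simp_all add: e_def divide_simps)
  have wK: "w \<in> K"
    using K(2) interior_subset by blast
  have P_near: "\<exists>z\<in>K. dist p z \<le> e" if "p \<in> convex hull (real_vec ` set ps)" for p
    using hausdorff_dist_le(1)[OF ps _ that] D_pos by (simp add: e_def)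
  have K_near: "\<exists>y\<in>convex hull (real_vec ` set ps). dist z y \<le> e" if "z \<in> K" for z
    using hausdorff_dist_le(2)[OF ps _ that] D_pos by (simp add: e_def)
  have norm_p: "norm p \<le> real B + 2" if p: "p \<in> real_vec ` set ps" for p
  proof -
    obtain z where "z \<in> K" "dist p z \<le> e"
      using P_near hull_inc[OF p] by blast
    then show ?thesis
      using bound[of z] e(2) norm_triangle_sub[of p z] by (simp add: dist_norm)
  qed
  have v': "norm (w - real_vec v) \<le> e"
    using v D_pos e(1) by (simp add: e_def divide_simps split: if_splits)
  then have norm_v: "norm (real_vec v) \<le> real B + 2"
    using bound[OF wK] e(2) norm_triangle_sub[of "real_vec v" w] by (simp add: norm_minus_commute)
  have Z: "real D * norm x \<le> real Z" if "norm x \<le> real B + 2" for x :: "real ^ 'm"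
    using that mult_left_mono[of "norm x" "real B + 2" "real D"] by (simp add: Z_def algebra_simps)
  have X: "norm (X p - real D *\<^sub>R p) \<le> real m" if "p \<in> real_vec ` set ps" for p
    using that norm_rounded[OF Z] norm_p[OF that] unfolding X_def m_def by auto
  have V: "norm (rounded D Z v - real D *\<^sub>R real_vec v) \<le> real m"
    unfolding m_def by (rule norm_rounded[OF Z[OF norm_v]])
  interpret approximated_convex_body K "real_vec ` set ps" w "real_vec v" "rounded D Z v" X e "real D"
    "D * (2 * B + 4 + 2 * m)" N
  proof
    show "bounded K"
      using bound unfolding bounded_iff by blast
    show "real_vec ` set ps \<noteq> {}"
      using K_near[OF wK] by auto
    show "norm (X p - rounded D Z v) \<le> real (D * (2 * B + 4 + 2 * m))" if p: "p \<in> real_vec ` set ps" for p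
    proof -
      have "X p - rounded D Z v =
          (X p - real D *\<^sub>R p) - (rounded D Z v - real D *\<^sub>R real_vec v) + real D *\<^sub>R (p - real_vec v)"
        by (simp add: scaleR_diff_right)
      also have "norm \<dots> \<le> norm (X p - real D *\<^sub>R p) + norm (rounded D Z v - real D *\<^sub>R real_vec v)
          + norm (real D *\<^sub>R (p - real_vec v))"
        by (intro norm_triangle_le add_right_mono norm_triangle_ineq4)
      also have "\<dots> \<le> real m + real m + real D * (2 * real B + 4)"
      proof (intro add_mono X[OF p] V)
        have "norm (p - real_vec v) \<le> 2 * real B + 4"
          using norm_p[OF p] norm_v norm_triangle_ineq4[of p "real_vec v"] by linarith
        then show "norm (real D *\<^sub>R (p - real_vec v)) \<le> real D * (2 * real B + 4)"
          by (simp add: mult_left_mono)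
      qed
      also have "\<dots> \<le> real D * (2 * real m) + real D * (2 * real B + 4)"
        using mult_right_mono[OF D_pos(1), of "2 * real m"] by simp
      finally show ?thesis
        by (simp add: algebra_simps)
    qed
    show "2 * CARD('m) * (D * (2 * B + 4 + 2 * m)) \<le> N"
      unfolding N_def m_def[symmetric] by (simp add: algebra_simps)
    have "m < 1 * (2 * m * 4)"
      using m by simp
    also have "\<dots> \<le> N"
      unfolding N_def using D_pos(2) by (intro mult_mono) auto
    finally show "CARD('m) < N"
      unfolding m_def .
    show "\<exists>z\<in>K. dist p z \<le> e" if "p \<in> real_vec ` set ps" for p
      by (rule P_near[OF hull_inc[OF that]])
  qed (use K K_near v' X V D_pos in \<open>auto simp: m_def\<close>)
  define t where "t = search m N D Z (points_code ps) (rat_vec_code v)"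
  have image: "(\<lambda>p. X p - rounded D Z v) ` real_vec ` set ps = (\<lambda>p. rounded D Z p - rounded D Z v) ` set ps"
    by (simp add: image_image X_def)
  have "(\<forall>i<t. test i) \<and> (t = N + 2 \<or> \<not> test t)"
    unfolding t_def search_def m_def image all_lists_direction_test by (rule funpow_search)
  then have r_t: "\<bar>radius - real t / real D\<bar> \<le> (2 + 2 * real m) / real D + 2 * e"
    using radius_approx[of t] unfolding m_def by auto
  define q where "q = Fract (int (t * D + 1)) (int (D * D))"
  have q: "real_of_rat q = real t / real D + 1 / (real D * real D)"
    using D_pos(2) by (simp add: q_def of_rat_rat field_simps)
  \<comment> \<open>The price of the added 1 in the numerator.\<close>
  have "0 \<le> 1 / (real D * real D)" "1 / (real D * real D) \<le> 1 / real D"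
    using D_pos by (simp_all add: divide_simps)
  then have "\<bar>radius - real_of_rat q\<bar> \<le> (2 + 2 * real m) / real D + 2 * e + 1 / real D"
    using r_t unfolding q by linarith
  also have "\<dots> = real c / real D"
    by (simp add: e_def c_def add_divide_distrib)
  also have "\<dots> < 1 / 2 ^ n"
  proof -
    have "real c < 2 ^ c"
      by (rule of_nat_less_two_power)
    then show ?thesis
      by (simp add: D_def power_add divide_simps)
  qed
  finally have "\<bar>radius - real_of_rat q\<bar> < 1 / 2 ^ n" .
  moreover have "radius_code m c (2 * m * (2 * B + 4 + 2 * m)) B
      (prod_encode (n, prod_encode (points_code ps, rat_vec_code v))) = rat_code q"
    unfolding q_def rat_code_coprime[OF D_pos(2), symmetric]
    by (simp only: radius_code_def pfst_prod_encode psnd_prod_encode t_def N_def Z_def D_def)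
  ultimately show ?thesis
    unfolding approx_real_def by metis
qed

theorem proposition3p4:
  fixes s :: "nat \<Rightarrow> 'x::metric_space"
    and f :: "'x \<Rightarrow> 'x"
    and \<Phi> :: "'x \<Rightarrow> real ^ 'm"
  assumes "compact (UNIV :: 'x set)"
    and "computable_metric_space s"
    and "computable_metric s"
    and "computable_on UNIV (approx_seq s) (approx_seq s) f"
    and "continuous_on UNIV \<Phi>"
    and "computable_set (Rot f \<Phi>)"
    and "interior (Rot f \<Phi>) \<noteq> {}"
    and "\<exists>\<psi>. turing_machine \<psi> \<and>
           (\<forall>n. \<exists>ps :: (rat ^ 'm) list. outputs \<psi> n (points_code ps) \<and>
              hausdorff_dist (convex hull (real_vec ` set ps)) (Rot f \<Phi>) \<le> ennreal (1 / 2 ^ n))"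
  shows "computable_on (interior (Rot f \<Phi>)) approx_vec approx_real
           (largest_radius (interior (Rot f \<Phi>)))"
proof -
  let ?K = "Rot f \<Phi>"
  obtain \<psi> where \<psi>: "turing_machine \<psi>" and polytope: "\<And>n. \<exists>ps :: (rat ^ 'm) list.
      outputs \<psi> n (points_code ps) \<and>
      hausdorff_dist (convex hull (real_vec ` set ps)) ?K \<le> ennreal (1 / 2 ^ n)"
    using assms(8) by blast
  have convex: "convex ?K"
    using assms(1,5) by (rule convex_Rot)
  \<comment> \<open>The polytope at precision 1 bounds the rotation set. B is a constant of the
    machine, so its existence is enough.\<close>
  obtain B :: nat where B: "\<And>z. z \<in> ?K \<Longrightarrow> norm z \<le> real B"
  proof -
    obtain ps :: "(rat ^ 'm) list" where
      ps: "hausdorff_dist (convex hull (real_vec ` set ps)) ?K \<le> ennreal 1"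
      using polytope[of 0] by auto
    have "bounded (convex hull (real_vec ` set ps))"
      by (intro bounded_convex_hull finite_imp_bounded) simp
    then obtain R where R: "\<And>y. y \<in> convex hull (real_vec ` set ps) \<Longrightarrow> norm y \<le> R"
      unfolding bounded_iff by blast
    have "norm z \<le> real (nat \<lceil>R + 2\<rceil>)" if z: "z \<in> ?K" for z
    proof -
      obtain y where "y \<in> convex hull (real_vec ` set ps)" "dist z y \<le> 2"
        using hausdorff_dist_le(2)[OF ps _ z] by auto
      then have "norm z \<le> R + 2"
        using R norm_triangle_sub[of z y] by (fastforce simp: dist_norm)
      then show ?thesis
        by linarith
    qed
    then show thesis
      using that by blast
  qed
  define m c where "m = CARD('m)" and "c = 2 * m + 7"
  define G where "G = radius_code m c (2 * m * (2 * B + 4 + 2 * m)) B"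
  obtain M where M: "oracle_turing_machine M" "\<And>\<phi> n y. outputs \<psi> (n + c) y \<Longrightarrow>
      oracle_outputs M \<phi> n (G (prod_encode (n, prod_encode (y, \<phi> (n + c)))))"
    using oracle_machine_of_prec[OF \<psi> prec_radius_code] unfolding G_def by metis
  have "\<exists>k. oracle_outputs M \<phi> n k \<and> approx_real (largest_radius (interior ?K) w) n k"
    if w: "w \<in> interior ?K" and \<phi>: "is_oracle approx_vec \<phi> w" for w \<phi> n
  proof -
    obtain ps :: "(rat ^ 'm) list" where ps: "outputs \<psi> (n + c) (points_code ps)"
      "hausdorff_dist (convex hull (real_vec ` set ps)) ?K \<le> ennreal (1 / 2 ^ (n + c))"
      using polytope by blast
    obtain v where v: "\<phi> (n + c) = rat_vec_code v" "norm (w - real_vec v) < 1 / 2 ^ (n + c)"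
      using \<phi> unfolding is_oracle_def approx_vec_def by blast
    have "approx_real (largest_radius (interior ?K) w) n
        (G (prod_encode (n, prod_encode (points_code ps, rat_vec_code v))))"
      using radius_code_correct[OF convex w B] ps(2) v(2) unfolding G_def c_def m_def by blast
    then show ?thesis
      using M(2)[OF ps(1), of \<phi>] v(1) by metis
  qed
  then show ?thesis
    unfolding computable_on_def using M(1) by blast
qed

end
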